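(* Let $(M,g)$ be a smooth $n$-dimensional Riemannian manifold and let $G$ be a general natural lifted metric of $g$ on the tangent bundle $TM$, so that $(TM,G)$ is a Riemannian manifold. If $(TM,G)$ has constant sectional curvature, then the base manifold $(M,g)$ is flat.
   Context: Let $(M,g)$ be a smooth $n$-dimensional Riemannian manifold with tangent bundle $\tau:TM\to M$. A local chart $(U,x^1,\dots,x^n)$ on $M$ induces the local chart $(\tau^{-1}(U),x^1,\dots,x^n,y^1,\dots,y^n)$ on $TM$, where $x^i$ stands for $x^i\circ\tau$ and $y^1,\dots,y^n$ are the components of the tangent vector $y\in\tau^{-1}(U)$ in the natural basis of $T_{\tau(y)}M$ given by the chart. Let $g_{ij}(x)$ be the components of $g$ and $\Gamma^h_{ki}(x)$ its Christoffel symbols. Set $$g_{0i}=y^kg_{ki},\qquad \Gamma^h_{0i}=y^k\Gamma^h_{ki},\qquad \frac{\delta}{\delta x^i}=\frac{\partial}{\partial x^i}-\Gamma^h_{0i}\frac{\partial}{\partial y^h}$$ (summation over repeated indices). The fields $\frac{\delta}{\delta x^1},\dots,\frac{\delta}{\delta x^n}$ span the horizontal distribution defined by the Levi-Civita connection of $g$, the fields $\frac{\partial}{\partial y^1},\dots,\frac{\partial}{\partial y^n}$ span the vertical distribution $\ker\tau_*$, and together they form a local frame on $TM$. The energy density of $y\in TM$ is $t=\frac12\|y\|^2=\frac12 g_{\tau(y)}(y,y)=\frac12 g_{ik}(x)y^iy^k\in[0,\infty)$. A general natural lifted metric $G$ on $TM$ is a metric of the form $$G\left(\tfrac{\delta}{\delta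 x^i},\tfrac{\delta}{\delta x^j}\right)=c_1g_{ij}+d_1g_{0i}g_{0j},\qquad G\left(\tfrac{\partial}{\partial y^i},\tfrac{\partial}{\partial y^j}\right)=c_2g_{ij}+d_2g_{0i}g_{0j},$$ $$G\left(\tfrac{\partial}{\partial y^i},\tfrac{\delta}{\delta x^j}\right)=G\left(\tfrac{\delta}{\delta x^i},\tfrac{\partial}{\partial y^j}\right)=c_3g_{ij}+d_3g_{0i}g_{0j},$$ where $c_1,c_2,c_3,d_1,d_2,d_3$ are six smooth functions of the energy density $t$. $(TM,G)$ has constant sectional curvature $k$ if the curvature tensor $K(X,Y)Z=\nabla_X\nabla_YZ-\nabla_Y\nabla_XZ-\nabla_{[X,Y]}Z$ of the Levi-Civita connection $\nabla$ of $G$ satisfies $K(X,Y)Z=k[G(Y,Z)X-G(X,Z)Y]$ for all vector fields $X,Y,Z$ on $TM$, where $k$ is a real constant. *)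

theory Defs
  imports "HOL-Analysis.Analysis"
begin

section \<open>Smooth maps\<close>

primrec Ck_on :: "nat \<Rightarrow> 'a::real_normed_vector set \<Rightarrow> ('a \<Rightarrow> 'b::real_normed_vector) \<Rightarrow> bool" where
  "Ck_on 0 = (\<lambda>S f. continuous_on S f)"
| "Ck_on (Suc k) = (\<lambda>S f. \<exists>f'. (\<forall>x\<in>S. (f has_derivative f' x) (at x)) \<and> (\<forall>v. Ck_on k S (\<lambda>x. f' x v)))"

definition smooth_on :: "'a::real_normed_vector set \<Rightarrow> ('a \<Rightarrow> 'b::real_normed_vector) \<Rightarrow> bool" where
  "smooth_on S f \<longleftrightarrow> (\<forall>k. Ck_on k S f)"

text \<open>Smoothness on the closed half-line, with one-sided derivatives at the end point 0.\<close>

definition smooth_halfline :: "(real \<Rightarrow> real) \<Rightarrow> bool" where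
  "smooth_halfline c \<longleftrightarrow>
     (\<exists>D :: nat \<Rightarrow> real \<Rightarrow> real. D 0 = c \<and>
        (\<forall>k. \<forall>t\<ge>0. (D k has_real_derivative D (Suc k) t) (at t within {0..})))"


section \<open>Smooth manifolds\<close>

text \<open>A manifold is given by an atlas, not necessarily maximal. A chart is a pair of a domain and a
  map that is only relevant on this domain. The point set is the union of the domains and
  the topology is the one determined by the charts.\<close>

type_synonym ('p, 'n) chart = "'p set \<times> ('p \<Rightarrow> (real, 'n) vec)"

definition chart_inv :: "('p, 'n::finite) chart \<Rightarrow> real^'n \<Rightarrow> 'p" where
  "chart_inv c = inv_into (fst c) (snd c)"

definition smooth_atlas :: "('p, 'n::finite) chart set \<Rightarrow> bool" where
  "smooth_atlas A \<longleftrightarrow>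
     (\<forall>c\<in>A. inj_on (snd c) (fst c) \<and> open (snd c ` fst c)) \<and>
     (\<forall>c\<in>A. \<forall>c'\<in>A. open (snd c ` (fst c \<inter> fst c')) \<and>
        smooth_on (snd c ` (fst c \<inter> fst c')) (snd c' \<circ> chart_inv c))"

definition points :: "('p, 'n::finite) chart set \<Rightarrow> 'p set" where
  "points A = (\<Union>c\<in>A. fst c)"

definition manifold_topology :: "('p, 'n::finite) chart set \<Rightarrow> 'p topology" where
  "manifold_topology A = topology (\<lambda>W. W \<subseteq> points A \<and> (\<forall>c\<in>A. open (snd c ` (W \<inter> fst c))))"

definition smooth_manifold :: "('p, 'n::finite) chart set \<Rightarrow> bool" where
  "smooth_manifold A \<longleftrightarrow> smooth_atlas A \<and>
     Hausdorff_space (manifold_topology A) \<and> second_countable (manifold_topology A)"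

lemma openin_manifold_topology:
  assumes "smooth_atlas A"
  shows "openin (manifold_topology A) W \<longleftrightarrow>
           W \<subseteq> points A \<and> (\<forall>c\<in>A. open (snd c ` (W \<inter> fst c)))"
proof -
  have 1: "open (snd c ` ((S \<inter> T) \<inter> fst c))"
    if "c \<in> A" "open (snd c ` (S \<inter> fst c))" "open (snd c ` (T \<inter> fst c))" for c S T
  proof -
    have "inj_on (snd c) (fst c)"
      using assms that(1) by (auto simp: smooth_atlas_def)
    then have "snd c ` ((S \<inter> T) \<inter> fst c) = snd c ` (S \<inter> fst c) \<inter> snd c ` (T \<inter> fst c)"
      by (fastforce simp: inj_on_def)
    then show ?thesis
      using that by (simp add: open_Int)
  qed
  have 2: "open (snd c ` (\<Union>K \<inter> fst c))" if "\<forall>S\<in>K. open (snd c ` (S \<inter> fst c))"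
    for c :: "('a, 'b) chart" and K
  proof -
    have "snd c ` (\<Union>K \<inter> fst c) = (\<Union>S\<in>K. snd c ` (S \<inter> fst c))"
      by auto
    then show ?thesis
      using that by (auto intro: open_Union)
  qed
  have "istopology (\<lambda>W. W \<subseteq> points A \<and> (\<forall>c\<in>A. open (snd c ` (W \<inter> fst c))))"
    unfolding istopology_def by (intro conjI allI impI ballI) (blast, blast intro: 1, blast, blast intro: 2)
  then show ?thesis
    by (simp add: manifold_topology_def topology_inverse')
qed


section \<open>Tangent vectors and vector fields\<close>

text \<open>A tangent vector at \<open>p\<close> is the family of its component vectors in all charts around \<open>p\<close>,
  related by the Jacobians of the transition maps. It is zero at every other argument, so
  that a tangent vector is determined by its components in a single chart.\<close>

type_synonym ('p, 'n) tvec = "('p, 'n) chart \<Rightarrow> (real, 'n) vec"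

definition transition_deriv ::
    "('p, 'n::finite) chart \<Rightarrow> ('p, 'n) chart \<Rightarrow> 'p \<Rightarrow> real^'n \<Rightarrow> real^'n" where
  "transition_deriv c c' p = frechet_derivative (snd c' \<circ> chart_inv c) (at (snd c p))"

definition tangent_space :: "('p, 'n::finite) chart set \<Rightarrow> 'p \<Rightarrow> ('p, 'n) tvec set" where
  "tangent_space A p = {v.
     (\<forall>c. \<not> (c \<in> A \<and> p \<in> fst c) \<longrightarrow> v c = 0) \<and>
     (\<forall>c\<in>A. \<forall>c'\<in>A. p \<in> fst c \<and> p \<in> fst c' \<longrightarrow> v c' = transition_deriv c c' p (v c))}"

text \<open>The tangent vector at \<open>p\<close> with component vector \<open>w\<close> in the chart \<open>c\<close>.\<close>

definition tangent_vector ::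
    "('p, 'n::finite) chart set \<Rightarrow> ('p, 'n) chart \<Rightarrow> 'p \<Rightarrow> real^'n \<Rightarrow> ('p, 'n) tvec" where
  "tangent_vector A c p w = (\<lambda>c'. if c' \<in> A \<and> p \<in> fst c' then transition_deriv c c' p w else 0)"

definition coord_vector ::
    "('p, 'n::finite) chart set \<Rightarrow> ('p, 'n) chart \<Rightarrow> 'n \<Rightarrow> 'p \<Rightarrow> ('p, 'n) tvec" where
  "coord_vector A c i p = tangent_vector A c p (axis i 1)"

definition vector_field :: "('p, 'n::finite) chart set \<Rightarrow> ('p \<Rightarrow> ('p, 'n) tvec) \<Rightarrow> bool" where
  "vector_field A X \<longleftrightarrow>
     (\<forall>p\<in>points A. X p \<in> tangent_space A p) \<and>
     (\<forall>c\<in>A. smooth_on (snd c ` fst c) (\<lambda>x. X (chart_inv c x) c))"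

text \<open>The partial derivative of \<open>F\<close> at \<open>p\<close> with respect to the \<open>i\<close>-th coordinate of \<open>c\<close>.\<close>

definition partial_deriv ::
    "('p, 'n::finite) chart \<Rightarrow> 'n \<Rightarrow> ('p \<Rightarrow> real) \<Rightarrow> 'p \<Rightarrow> real" where
  "partial_deriv c i F p = frechet_derivative (F \<circ> chart_inv c) (at (snd c p)) (axis i 1)"

definition lie_bracket ::
    "('p, 'n::finite) chart set \<Rightarrow> ('p \<Rightarrow> ('p, 'n) tvec) \<Rightarrow> ('p \<Rightarrow> ('p, 'n) tvec) \<Rightarrow> 'p \<Rightarrow> ('p, 'n) tvec"
  where
  "lie_bracket A X Y p = (\<lambda>c. if c \<in> A \<and> p \<in> fst c then
     (\<chi> h. \<Sum>i\<in>UNIV. X p c $ i * partial_deriv c i (\<lambda>q. Y q c $ h) p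
                   - Y p c $ i * partial_deriv c i (\<lambda>q. X q c $ h) p)
     else 0)"


section \<open>Riemannian metrics, Levi-Civita connection and curvature\<close>

type_synonym ('p, 'n) metric = "'p \<Rightarrow> ('p, 'n) tvec \<Rightarrow> ('p, 'n) tvec \<Rightarrow> real"

definition metric_coeff ::
    "('p, 'n::finite) chart set \<Rightarrow> ('p, 'n) metric \<Rightarrow> ('p, 'n) chart \<Rightarrow> 'n \<Rightarrow> 'n \<Rightarrow> 'p \<Rightarrow> real" where
  "metric_coeff A g c i j p = g p (coord_vector A c i p) (coord_vector A c j p)"

definition riemannian_metric :: "('p, 'n::finite) chart set \<Rightarrow> ('p, 'n) metric \<Rightarrow> bool" where
  "riemannian_metric A g \<longleftrightarrow>
     (\<forall>p\<in>points A. \<forall>u\<in>tangent_space A p. \<forall>v\<in>tangent_space A p.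
        g p u v = g p v u \<and>
        (u \<noteq> (\<lambda>_. 0) \<longrightarrow> g p u u > 0) \<and>
        (\<forall>w\<in>tangent_space A p. \<forall>a b. g p (\<lambda>c. a *\<^sub>R u c + b *\<^sub>R v c) w = a * g p u w + b * g p v w)) \<and>
     (\<forall>c\<in>A. \<forall>i j. smooth_on (snd c ` fst c) (\<lambda>x. metric_coeff A g c i j (chart_inv c x)))"

definition riemannian_manifold :: "('p, 'n::finite) chart set \<Rightarrow> ('p, 'n) metric \<Rightarrow> bool" where
  "riemannian_manifold A g \<longleftrightarrow> smooth_manifold A \<and> riemannian_metric A g"

text \<open>\<open>christoffel A g c h k i\<close> is the symbol with upper index \<open>h\<close> and lower indices \<open>k\<close>, \<open>i\<close>.\<close>

definition christoffel ::
    "('p, 'n::finite) chart set \<Rightarrow> ('p, 'n) metric \<Rightarrow> ('p, 'n) chart \<Rightarrow> 'n \<Rightarrow> 'n \<Rightarrow> 'n \<Rightarrow> 'p \<Rightarrow> real" where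
  "christoffel A g c h k i p =
     (\<Sum>l\<in>UNIV. matrix_inv (\<chi> a b. metric_coeff A g c a b p) $ h $ l *
        (partial_deriv c k (metric_coeff A g c l i) p
         + partial_deriv c i (metric_coeff A g c l k) p
         - partial_deriv c l (metric_coeff A g c k i) p)) / 2"

definition levi_civita ::
    "('p, 'n::finite) chart set \<Rightarrow> ('p, 'n) metric \<Rightarrow>
     ('p \<Rightarrow> ('p, 'n) tvec) \<Rightarrow> ('p \<Rightarrow> ('p, 'n) tvec) \<Rightarrow> 'p \<Rightarrow> ('p, 'n) tvec" where
  "levi_civita A g X Y p = (\<lambda>c. if c \<in> A \<and> p \<in> fst c then
     (\<chi> h. (\<Sum>i\<in>UNIV. X p c $ i * partial_deriv c i (\<lambda>q. Y q c $ h) p)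
        + (\<Sum>i\<in>UNIV. \<Sum>k\<in>UNIV. christoffel A g c h i k p * X p c $ i * Y p c $ k))
     else 0)"

definition curvature ::
    "('p, 'n::finite) chart set \<Rightarrow> ('p, 'n) metric \<Rightarrow>
     ('p \<Rightarrow> ('p, 'n) tvec) \<Rightarrow> ('p \<Rightarrow> ('p, 'n) tvec) \<Rightarrow> ('p \<Rightarrow> ('p, 'n) tvec) \<Rightarrow> 'p \<Rightarrow> ('p, 'n) tvec" where
  "curvature A g X Y Z p = (\<lambda>c.
     levi_civita A g X (levi_civita A g Y Z) p c
     - levi_civita A g Y (levi_civita A g X Z) p c
     - levi_civita A g (lie_bracket A X Y) Z p c)"

definition constant_sectional_curvature ::
    "('p, 'n::finite) chart set \<Rightarrow> ('p, 'n) metric \<Rightarrow> real \<Rightarrow> bool" where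
  "constant_sectional_curvature A g k \<longleftrightarrow>
     (\<forall>X Y Z. vector_field A X \<and> vector_field A Y \<and> vector_field A Z \<longrightarrow>
        (\<forall>p\<in>points A. curvature A g X Y Z p =
           (\<lambda>c. k *\<^sub>R (g p (Y p) (Z p) *\<^sub>R X p c - g p (X p) (Z p) *\<^sub>R Y p c))))"

definition flat :: "('p, 'n::finite) chart set \<Rightarrow> ('p, 'n) metric \<Rightarrow> bool" where
  "flat A g \<longleftrightarrow>
     (\<forall>X Y Z. vector_field A X \<and> vector_field A Y \<and> vector_field A Z \<longrightarrow>
        (\<forall>p\<in>points A. curvature A g X Y Z p = (\<lambda>_. 0)))"


section \<open>The tangent bundle and its general natural lifted metrics\<close>

text \<open>The induced coordinates are indexed by the sum type \<open>'n + 'n\<close>: the index \<open>Inl i\<close> stands for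
  $x^i$ and \<open>Inr i\<close> for $y^i$.\<close>

definition tangent_chart ::
    "('p, 'n::finite) chart set \<Rightarrow> ('p, 'n) chart \<Rightarrow> ('p \<times> ('p, 'n) tvec, 'n + 'n) chart" where
  "tangent_chart A c =
     (SIGMA p:fst c. tangent_space A p,
      \<lambda>(p, y). \<chi> a. case a of Inl i \<Rightarrow> snd c p $ i | Inr i \<Rightarrow> y c $ i)"

definition tangent_atlas ::
    "('p, 'n::finite) chart set \<Rightarrow> ('p \<times> ('p, 'n) tvec, 'n + 'n) chart set" where
  "tangent_atlas A = tangent_chart A ` A"

definition vertical_frame ::
    "('p, 'n::finite) chart set \<Rightarrow> ('p, 'n) chart \<Rightarrow> 'n \<Rightarrow> 'p \<times> ('p, 'n) tvec
       \<Rightarrow> ('p \<times> ('p, 'n) tvec, 'n + 'n) tvec" where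
  "vertical_frame A c i z = coord_vector (tangent_atlas A) (tangent_chart A c) (Inr i) z"

definition christoffel0 ::
    "('p, 'n::finite) chart set \<Rightarrow> ('p, 'n) metric \<Rightarrow> ('p, 'n) chart \<Rightarrow> 'n \<Rightarrow> 'n
       \<Rightarrow> 'p \<times> ('p, 'n) tvec \<Rightarrow> real" where
  "christoffel0 A g c h i = (\<lambda>(p, y). \<Sum>k\<in>UNIV. y c $ k * christoffel A g c h k i p)"

definition metric_coeff0 ::
    "('p, 'n::finite) chart set \<Rightarrow> ('p, 'n) metric \<Rightarrow> ('p, 'n) chart \<Rightarrow> 'n
       \<Rightarrow> 'p \<times> ('p, 'n) tvec \<Rightarrow> real" where
  "metric_coeff0 A g c i = (\<lambda>(p, y). \<Sum>k\<in>UNIV. y c $ k * metric_coeff A g c k i p)"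

text \<open>The adapted frame field $\delta/\delta x^i$.\<close>

definition horizontal_frame ::
    "('p, 'n::finite) chart set \<Rightarrow> ('p, 'n) metric \<Rightarrow> ('p, 'n) chart \<Rightarrow> 'n \<Rightarrow> 'p \<times> ('p, 'n) tvec
       \<Rightarrow> ('p \<times> ('p, 'n) tvec, 'n + 'n) tvec" where
  "horizontal_frame A g c i z = (\<lambda>C.
     coord_vector (tangent_atlas A) (tangent_chart A c) (Inl i) z C
     - (\<Sum>h\<in>UNIV. christoffel0 A g c h i z *\<^sub>R vertical_frame A c h z C))"

definition energy :: "('p, 'n::finite) metric \<Rightarrow> 'p \<times> ('p, 'n) tvec \<Rightarrow> real" where
  "energy g = (\<lambda>(p, y). g p y y / 2)"

definition general_natural_lift ::
    "('p, 'n::finite) chart set \<Rightarrow> ('p, 'n) metric \<Rightarrow> ('p \<times> ('p, 'n) tvec, 'n + 'n) metric \<Rightarrow> bool"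
  where
  "general_natural_lift A g G \<longleftrightarrow>
     (\<exists>c1 c2 c3 d1 d2 d3.
        (\<forall>f\<in>{c1, c2, c3, d1, d2, d3}. smooth_halfline f) \<and>
        (\<forall>c\<in>A. \<forall>p\<in>fst c. \<forall>y\<in>tangent_space A p. \<forall>i j.
           let z = (p, y); t = energy g z;
               gij = metric_coeff A g c i j p;
               g0ij = metric_coeff0 A g c i z * metric_coeff0 A g c j z;
               hor = \<lambda>i. horizontal_frame A g c i z;
               ver = \<lambda>i. vertical_frame A c i z
           in G z (hor i) (hor j) = c1 t * gij + d1 t * g0ij \<and>
              G z (ver i) (ver j) = c2 t * gij + d2 t * g0ij \<and>
              G z (ver i) (hor j) = c3 t * gij + d3 t * g0ij \<and>
              G z (hor i) (ver j) = c3 t * gij + d3 t * g0ij))"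

end

theory Submission
  imports Defs
begin

text \<open>
  Everything happens along the zero section of the tangent bundle. There the functions
  \<open>c\<^sub>i\<close> and \<open>d\<^sub>i\<close> enter only through the constants \<open>c\<^sub>i(0)\<close>: the energy density vanishes to
  second order at \<open>y = 0\<close>, and so do the products \<open>g\<^sub>0\<^sub>i g\<^sub>0\<^sub>j\<close>. The first derivatives of \<open>G\<close> at \<open>y = 0\<close>
  are then combinations of derivatives of \<open>g\<close>, and one computes that the Christoffel symbols
  of \<open>G\<close> with one horizontal and one vertical lower index have no horizontal component and
  have the Christoffel symbols of \<open>g\<close> as vertical components (\<open>christoffel_zero_section\<close>). So
  along the zero section, covariant differentiation of a vertical field in a horizontal
  direction is covariant differentiation on the base (\<open>levi_civita_zero_section\<close>).

  Let \<open>X\<^sup>c\<close> be the complete lift and \<open>Z\<^sup>v\<close> the vertical lift of fields on \<open>M\<close>. These are smooth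
  fields on the whole of \<open>TM\<close>, and at a point of the zero section \<open>X\<^sup>c\<close> is the horizontal copy
  of \<open>X\<close>. Iterating the previous computation gives \<open>K(X\<^sup>c, Y\<^sup>c) Z\<^sup>v = (R(X, Y) Z)\<^sup>v\<close> on the zero
  section, where \<open>R\<close> is the curvature of \<open>g\<close> (\<open>curvature_zero_section\<close>). Only derivatives along the
  zero section enter, hence no second derivatives of \<open>G\<close> in fibre directions.

  If \<open>G\<close> has constant sectional curvature, then \<open>K(X\<^sup>c, Y\<^sup>c) Z\<^sup>v\<close> is a linear combination of \<open>X\<^sup>c\<close> and
  \<open>Y\<^sup>c\<close>, and is therefore horizontal there. Being also vertical, it is zero, and so
  \<open>R(X, Y) Z = 0\<close>.
\<close>

section \<open>Smooth maps\<close>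

lemma Ck_on_SucE:
  assumes "Ck_on (Suc k) S f"
  obtains f' where "\<forall>x\<in>S. (f has_derivative f' x) (at x)" "\<forall>v. Ck_on k S (\<lambda>x. f' x v)"
  using assms that unfolding Ck_on.simps(2)[of k] by (elim exE conjE) (rule that)

lemma Ck_on_SucI:
  assumes "\<And>x. x \<in> S \<Longrightarrow> (f has_derivative f' x) (at x)" "\<And>v. Ck_on k S (\<lambda>x. f' x v)"
  shows "Ck_on (Suc k) S f"
  unfolding Ck_on.simps(2)[of k] by (intro exI[of _ f'] conjI ballI allI assms)

lemma Ck_on_cong:
  assumes "open S" "\<And>x. x \<in> S \<Longrightarrow> f x = g x" "Ck_on k S f"
  shows "Ck_on k S g"
proof (cases k)
  case 0
  then show ?thesis
    using assms continuous_on_cong[OF refl, of S f g] by simp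
next
  case (Suc m)
  from assms(3)[unfolded Suc] obtain f' where f':
    "\<forall>x\<in>S. (f has_derivative f' x) (at x)" "\<forall>v. Ck_on m S (\<lambda>x. f' x v)"
    by (rule Ck_on_SucE)
  have "(g has_derivative f' x) (at x)" if "x \<in> S" for x
    using has_derivative_transform_within_open[OF f'(1)[rule_format] assms(1)] that assms(2) by blast
  then show ?thesis
    unfolding Suc by (intro Ck_on_SucI[of S g f'] f'(2)[rule_format])
qed

lemma Ck_on_SucD: "Ck_on (Suc k) S f \<Longrightarrow> Ck_on k S f"
proof (induction k arbitrary: f)
  case 0
  then obtain f' where "\<forall>x\<in>S. (f has_derivative f' x) (at x)" "\<forall>v. Ck_on 0 S (\<lambda>x. f' x v)"
    by (rule Ck_on_SucE)
  then have "\<forall>x\<in>S. isCont f x"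
    by (blast intro: has_derivative_continuous)
  then show ?case
    by (simp add: continuous_at_imp_continuous_on)
next
  case (Suc k)
  from Suc.prems obtain f' where
    f': "\<forall>x\<in>S. (f has_derivative f' x) (at x)" "\<forall>v. Ck_on (Suc k) S (\<lambda>x. f' x v)"
    by (rule Ck_on_SucE)
  show ?case
    by (rule Ck_on_SucI[of S f f']) (simp add: f', intro Suc.IH f'(2)[rule_format])
qed

lemma Ck_on_const: "Ck_on k S (\<lambda>x. a)"
proof (induction k arbitrary: a)
  case (Suc k)
  show ?case
    by (rule Ck_on_SucI[of S _ "\<lambda>x v. 0"]) (auto intro: Suc.IH)
qed simp

lemma Ck_on_bounded_linear_comp:
  assumes "bounded_linear L"
  shows "Ck_on k S f \<Longrightarrow> Ck_on k S (\<lambda>x. L (f x))"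
proof (induction k arbitrary: f)
  case 0
  then show ?case
    using assms by (simp add: bounded_linear.continuous_on)
next
  case (Suc k)
  from Suc.prems obtain f' where
    "\<forall>x\<in>S. (f has_derivative f' x) (at x)" "\<forall>v. Ck_on k S (\<lambda>x. f' x v)"
    by (rule Ck_on_SucE)
  note f' = this
  show ?case
    by (intro Ck_on_SucI[of S _ "\<lambda>x v. L (f' x v)"] bounded_linear.has_derivative[OF assms] Suc.IH f'[rule_format])
qed

lemma Ck_on_comp_bounded_linear:
  assumes "bounded_linear L" and "L ` S \<subseteq> T"
  shows "Ck_on k T f \<Longrightarrow> Ck_on k S (\<lambda>x. f (L x))"
proof (induction k arbitrary: f)
  case 0
  then have "continuous_on T f"
    by simp
  from continuous_on_compose2[OF this linear_continuous_on[OF assms(1)] assms(2)] show ?case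
    by simp
next
  case (Suc k)
  from Suc.prems obtain f' where f':
    "\<forall>x\<in>T. (f has_derivative f' x) (at x)" "\<forall>v. Ck_on k T (\<lambda>x. f' x v)"
    by (rule Ck_on_SucE)
  have "((\<lambda>x. f (L x)) has_derivative (\<lambda>v. f' (L x) (L v))) (at x)" if "x \<in> S" for x
    using that assms(2)
    by (intro has_derivative_compose[OF bounded_linear_imp_has_derivative[OF assms(1)]] f'[rule_format]) auto
  then show ?case
    by (intro Ck_on_SucI[of S _ "\<lambda>x v. f' (L x) (L v)"] Suc.IH f'[rule_format])
qed

lemma Ck_on_add: "Ck_on k S f \<Longrightarrow> Ck_on k S g \<Longrightarrow> Ck_on k S (\<lambda>x. f x + g x)"
proof (induction k arbitrary: f g)
  case 0
  then show ?case
    by (simp add: continuous_on_add)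
next
  case (Suc k)
  from Suc.prems(1) obtain f' where
    "\<forall>x\<in>S. (f has_derivative f' x) (at x)" "\<forall>v. Ck_on k S (\<lambda>x. f' x v)"
    by (rule Ck_on_SucE)
  moreover from Suc.prems(2) obtain g' where
    "\<forall>x\<in>S. (g has_derivative g' x) (at x)" "\<forall>v. Ck_on k S (\<lambda>x. g' x v)"
    by (rule Ck_on_SucE)
  ultimately show ?case
    by (intro Ck_on_SucI[of S _ "\<lambda>x v. f' x v + g' x v"] has_derivative_add Suc.IH) blast+
qed

lemma Ck_on_sum: "(\<And>i. i \<in> I \<Longrightarrow> Ck_on k S (f i)) \<Longrightarrow> Ck_on k S (\<lambda>x. \<Sum>i\<in>I. f i x)"
  by (induction I rule: infinite_finite_induct) (simp_all add: Ck_on_const Ck_on_add)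

lemma Ck_on_scaleR: "Ck_on k S f \<Longrightarrow> Ck_on k S g \<Longrightarrow> Ck_on k S (\<lambda>x. f x *\<^sub>R g x)"
proof (induction k arbitrary: f g)
  case 0
  then show ?case
    by (simp add: continuous_on_scaleR)
next
  case (Suc k)
  from Suc.prems(1) obtain f' where f':
    "\<forall>x\<in>S. (f has_derivative f' x) (at x)" "\<forall>v. Ck_on k S (\<lambda>x. f' x v)"
    by (rule Ck_on_SucE)
  from Suc.prems(2) obtain g' where g':
    "\<forall>x\<in>S. (g has_derivative g' x) (at x)" "\<forall>v. Ck_on k S (\<lambda>x. g' x v)"
    by (rule Ck_on_SucE)
  show ?case
    by (intro Ck_on_SucI[of S _ "\<lambda>x v. f x *\<^sub>R g' x v + f' x v *\<^sub>R g x"] has_derivative_scaleR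
        Ck_on_add Suc.IH f'[rule_format] g'[rule_format] Ck_on_SucD[OF Suc.prems(1)] Ck_on_SucD[OF Suc.prems(2)])
qed

lemma smooth_on_cong: "open S \<Longrightarrow> (\<And>x. x \<in> S \<Longrightarrow> f x = g x) \<Longrightarrow> smooth_on S f \<Longrightarrow> smooth_on S g"
  unfolding smooth_on_def using Ck_on_cong[of S f g] by blast

lemma smooth_on_bounded_linear_comp:
  "bounded_linear L \<Longrightarrow> smooth_on S f \<Longrightarrow> smooth_on S (\<lambda>x. L (f x))"
  by (simp add: smooth_on_def Ck_on_bounded_linear_comp)

lemma smooth_on_comp_bounded_linear:
  "bounded_linear L \<Longrightarrow> L ` S \<subseteq> T \<Longrightarrow> smooth_on T f \<Longrightarrow> smooth_on S (\<lambda>x. f (L x))"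
  unfolding smooth_on_def using Ck_on_comp_bounded_linear by blast

lemma smooth_on_bounded_linear: "bounded_linear L \<Longrightarrow> smooth_on S L"
  unfolding smooth_on_def
proof
  fix k assume "bounded_linear L"
  then show "Ck_on k S L"
    by (cases k) (simp add: linear_continuous_on, auto simp del: Ck_on.simps
      intro!: Ck_on_SucI[of S L "\<lambda>x. L"] Ck_on_const bounded_linear_imp_has_derivative)
qed

lemma smooth_on_add: "smooth_on S f \<Longrightarrow> smooth_on S g \<Longrightarrow> smooth_on S (\<lambda>x. f x + g x)"
  by (simp add: smooth_on_def Ck_on_add)

lemma smooth_on_sum: "(\<And>i. i \<in> I \<Longrightarrow> smooth_on S (f i)) \<Longrightarrow> smooth_on S (\<lambda>x. \<Sum>i\<in>I. f i x)"
  by (simp add: smooth_on_def Ck_on_sum)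

lemma smooth_on_scaleR: "smooth_on S f \<Longrightarrow> smooth_on S g \<Longrightarrow> smooth_on S (\<lambda>x. f x *\<^sub>R g x)"
  by (simp add: smooth_on_def Ck_on_scaleR)

lemma smooth_on_differentiable: "smooth_on S f \<Longrightarrow> x \<in> S \<Longrightarrow> f differentiable (at x)"
proof -
  assume "smooth_on S f" "x \<in> S"
  then have "Ck_on (Suc 0) S f"
    unfolding smooth_on_def by blast
  then show "f differentiable (at x)"
    by (rule Ck_on_SucE) (use \<open>x \<in> S\<close> in \<open>blast intro: differentiableI\<close>)
qed

lemma smooth_on_frechet_derivative:
  assumes "open S" "smooth_on S f"
  shows "smooth_on S (\<lambda>x. frechet_derivative f (at x) v)"
  unfolding smooth_on_def
proof
  fix k
  from assms(2) have "Ck_on (Suc k) S f"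
    unfolding smooth_on_def by blast
  then obtain f' where f':
    "\<forall>x\<in>S. (f has_derivative f' x) (at x)" "\<forall>v. Ck_on k S (\<lambda>x. f' x v)"
    by (rule Ck_on_SucE)
  have "f' x v = frechet_derivative f (at x) v" if "x \<in> S" for x
    using frechet_derivative_at[OF f'(1)[rule_format, OF that]] by simp
  then show "Ck_on k S (\<lambda>x. frechet_derivative f (at x) v)"
    by (rule Ck_on_cong[OF assms(1) _ f'(2)[rule_format]])
qed

lemma smooth_on_imp_continuous_on: "smooth_on S f \<Longrightarrow> continuous_on S f"
  unfolding smooth_on_def by (drule spec[of _ 0]) simp

text \<open>The mean value theorem, applied in the direction \<open>u\<close> and then in the direction \<open>v\<close>, turns the
  second difference into a mixed derivative at an intermediate point. The second difference
  is symmetric in \<open>u\<close> and \<open>v\<close>, which is why the mixed derivatives agree.\<close>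

lemma second_difference_mean_value:
  fixes f :: "'a::real_normed_vector \<Rightarrow> real"
  assumes "open S" "smooth_on S f" "s > 0"
    and inS: "\<And>a b. 0 \<le> a \<Longrightarrow> a \<le> s \<Longrightarrow> 0 \<le> b \<Longrightarrow> b \<le> s \<Longrightarrow> x + a *\<^sub>R u + b *\<^sub>R v \<in> S"
  shows "\<exists>a b. 0 < a \<and> a < s \<and> 0 < b \<and> b < s \<and>
    f (x + s *\<^sub>R u + s *\<^sub>R v) - f (x + s *\<^sub>R u) - f (x + s *\<^sub>R v) + f x
      = s * s * frechet_derivative (\<lambda>z. frechet_derivative f (at z) u) (at (x + a *\<^sub>R u + b *\<^sub>R v)) v"
proof -
  have line: "((\<lambda>r. h (y + r *\<^sub>R w)) has_real_derivative frechet_derivative h (at (y + r *\<^sub>R w)) w) (at r)"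
    if "h differentiable (at (y + r *\<^sub>R w))" for h :: "'a \<Rightarrow> real" and y w :: 'a and r :: real
  proof -
    have "(h has_derivative frechet_derivative h (at (y + r *\<^sub>R w))) (at (y + r *\<^sub>R w))"
      using that frechet_derivative_works by blast
    moreover have "((\<lambda>r. y + r *\<^sub>R w) has_derivative (\<lambda>r. r *\<^sub>R w)) (at r)"
      by (auto intro!: derivative_eq_intros)
    ultimately have "((\<lambda>r. h (y + r *\<^sub>R w)) has_derivative
        (\<lambda>r'. frechet_derivative h (at (y + r *\<^sub>R w)) (r' *\<^sub>R w))) (at r)"
      by (rule has_derivative_compose[rotated])
    then show ?thesis
      using linear_frechet_derivative[OF that]
      unfolding has_field_derivative_def
      by (elim has_derivative_eq_rhs) (simp add: fun_eq_iff linear_cmul)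
  qed
  let ?\<phi> = "\<lambda>r. f (x + s *\<^sub>R v + r *\<^sub>R u) - f (x + r *\<^sub>R u)"
  have S1: "x + s *\<^sub>R v + r *\<^sub>R u \<in> S" "x + r *\<^sub>R u \<in> S" if "0 \<le> r" "r \<le> s" for r
    using inS[of r s] inS[of r 0] that assms(3) by (auto simp: algebra_simps)
  have "\<exists>a>0. a < s \<and> ?\<phi> s - ?\<phi> 0 = (s - 0) *
      (frechet_derivative f (at (x + s *\<^sub>R v + a *\<^sub>R u)) u - frechet_derivative f (at (x + a *\<^sub>R u)) u)"
    by (rule MVT2[OF assms(3) DERIV_diff[OF line[of f "x + s *\<^sub>R v" _ u] line[of f x _ u]]])
      (simp_all add: smooth_on_differentiable[OF assms(2)] S1)
  then obtain a where a: "0 < a" "a < s" "?\<phi> s - ?\<phi> 0 = s *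
      (frechet_derivative f (at (x + s *\<^sub>R v + a *\<^sub>R u)) u - frechet_derivative f (at (x + a *\<^sub>R u)) u)"
    by auto
  let ?d = "\<lambda>z. frechet_derivative f (at z) u"
  have S2: "x + a *\<^sub>R u + r *\<^sub>R v \<in> S" if "0 \<le> r" "r \<le> s" for r
    using inS[of a r] that a by auto
  have "\<exists>b>0. b < s \<and> ?d (x + a *\<^sub>R u + s *\<^sub>R v) - ?d (x + a *\<^sub>R u + 0 *\<^sub>R v) = (s - 0) *
      frechet_derivative ?d (at (x + a *\<^sub>R u + b *\<^sub>R v)) v"
    by (rule MVT2[OF assms(3) line[of ?d "x + a *\<^sub>R u" _ v]])
      (simp add: smooth_on_differentiable[OF smooth_on_frechet_derivative[OF assms(1,2)]] S2)
  then obtain b where "0 < b" "b < s" "?d (x + a *\<^sub>R u + s *\<^sub>R v) - ?d (x + a *\<^sub>R u) = s *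
      frechet_derivative ?d (at (x + a *\<^sub>R u + b *\<^sub>R v)) v"
    by auto
  with a show ?thesis
    by (intro exI[of _ a] exI[of _ b]) (auto simp: algebra_simps)
qed

text \<open>By symmetry in \<open>u\<close> and \<open>v\<close> one inequality suffices. If it failed, then by continuity a
  constant \<open>m\<close> would separate the two mixed derivatives on a whole ball, although both attain the
  second difference quotient of a small parallelogram somewhere in this ball.\<close>

lemma mixed_derivatives_le:
  fixes f :: "'a::real_normed_vector \<Rightarrow> real"
  assumes "open S" "smooth_on S f" "x \<in> S"
  shows "frechet_derivative (\<lambda>z. frechet_derivative f (at z) u) (at x) v
       \<le> frechet_derivative (\<lambda>z. frechet_derivative f (at z) v) (at x) u"
proof (rule ccontr)
  define P where "P = (\<lambda>x. frechet_derivative (\<lambda>z. frechet_derivative f (at z) u) (at x) v)"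
  define Q where "Q = (\<lambda>x. frechet_derivative (\<lambda>z. frechet_derivative f (at z) v) (at x) u)"
  assume "\<not> ?thesis"
  then have "Q x < P x"
    by (simp add: P_def Q_def)
  then obtain m where m: "Q x < m" "m < P x"
    using dense by blast
  have "continuous_on S P" "continuous_on S Q"
    unfolding P_def Q_def using assms(1,2)
    by (auto intro!: smooth_on_imp_continuous_on smooth_on_frechet_derivative)
  then have "(P \<longlongrightarrow> P x) (nhds x)" "(Q \<longlongrightarrow> Q x) (nhds x)"
    using assms by (auto simp: continuous_on_eq_continuous_at isCont_def tendsto_at_iff_tendsto_nhds)
  then have "eventually (\<lambda>y. m < P y) (nhds x)" "eventually (\<lambda>y. Q y < m) (nhds x)"
    using m by (auto simp: order_tendsto_iff)
  moreover have "eventually (\<lambda>y. y \<in> S) (nhds x)"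
    using assms eventually_nhds by blast
  ultimately have "eventually (\<lambda>y. m < P y \<and> Q y < m \<and> y \<in> S) (nhds x)"
    by eventually_elim auto
  then obtain e where e: "e > 0" "\<And>y. dist y x < e \<Longrightarrow> m < P y \<and> Q y < m \<and> y \<in> S"
    by (auto simp: eventually_nhds_metric)
  \<comment> \<open>The parallelogram spanned by \<open>s u\<close> and \<open>s v\<close> at \<open>x\<close> stays inside the ball of radius \<open>e\<close>.\<close>
  define s where "s = e / (2 * (norm u + norm v + 1))"
  have pos: "norm u + norm v + 1 > 0"
    by (simp add: add_nonneg_pos)
  then have s: "s > 0" "s * (norm u + norm v) < e"
    using e(1) by (auto simp: s_def field_simps add_nonneg_pos intro: add_nonneg_pos)
  have ball: "dist (x + a *\<^sub>R u + b *\<^sub>R v) x < e" if "0 \<le> a" "a \<le> s" "0 \<le> b" "b \<le> s" for a b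
  proof -
    have "dist (x + a *\<^sub>R u + b *\<^sub>R v) x = norm (a *\<^sub>R u + b *\<^sub>R v)"
      by (simp add: dist_norm)
    also have "\<dots> \<le> a * norm u + b * norm v"
      using that norm_triangle_ineq[of "a *\<^sub>R u" "b *\<^sub>R v"] by simp
    also have "\<dots> \<le> s * norm u + s * norm v"
      using that by (intro add_mono mult_right_mono) auto
    finally show ?thesis
      using s(2) by (simp add: algebra_simps)
  qed
  have swap: "x + a *\<^sub>R v + b *\<^sub>R u = x + b *\<^sub>R u + a *\<^sub>R v" for a b
    by (simp add: algebra_simps)
  have inS: "x + a *\<^sub>R u + b *\<^sub>R v \<in> S" if "0 \<le> a" "a \<le> s" "0 \<le> b" "b \<le> s" for a b
    using e(2)[OF ball] that by blast
  have inS': "x + a *\<^sub>R v + b *\<^sub>R u \<in> S" if "0 \<le> a" "a \<le> s" "0 \<le> b" "b \<le> s" for a b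
    using inS[of b a] that by (simp only: swap)
  let ?\<Delta> = "f (x + s *\<^sub>R u + s *\<^sub>R v) - f (x + s *\<^sub>R u) - f (x + s *\<^sub>R v) + f x"
  obtain a b where ab: "0 < a" "a < s" "0 < b" "b < s" "?\<Delta> = s * s * P (x + a *\<^sub>R u + b *\<^sub>R v)"
    using second_difference_mean_value[OF assms(1,2) s(1) inS] unfolding P_def by blast
  obtain c d where cd: "0 < c" "c < s" "0 < d" "d < s"
    "f (x + s *\<^sub>R v + s *\<^sub>R u) - f (x + s *\<^sub>R v) - f (x + s *\<^sub>R u) + f x
      = s * s * Q (x + c *\<^sub>R v + d *\<^sub>R u)"
    using second_difference_mean_value[OF assms(1,2) s(1) inS'] unfolding Q_def by blast
  have "?\<Delta> = s * s * Q (x + d *\<^sub>R u + c *\<^sub>R v)"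
    using cd(5) unfolding swap by linarith
  then have "P (x + a *\<^sub>R u + b *\<^sub>R v) = Q (x + d *\<^sub>R u + c *\<^sub>R v)"
    using ab(5) s(1) by simp
  moreover have "m < P (x + a *\<^sub>R u + b *\<^sub>R v)"
    using e(2)[OF ball] ab by simp
  moreover have "Q (x + d *\<^sub>R u + c *\<^sub>R v) < m"
    using e(2)[OF ball] cd by simp
  ultimately show False
    by simp
qed

lemma frechet_derivative_bounded_linear_comp:
  assumes "bounded_linear L" "f differentiable (at x)"
  shows "frechet_derivative (\<lambda>z. L (f z)) (at x) v = L (frechet_derivative f (at x) v)"
proof -
  have "((\<lambda>z. L (f z)) has_derivative (\<lambda>v. L (frechet_derivative f (at x) v))) (at x)"
    by (rule bounded_linear.has_derivative[OF assms(1) frechet_derivative_works[THEN iffD1, OF assms(2)]])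
  from fun_cong[OF frechet_derivative_at[OF this]] show ?thesis
    by simp
qed

lemma mixed_derivatives_eq:
  fixes f :: "'a::real_normed_vector \<Rightarrow> real^'n::finite"
  assumes "open S" "smooth_on S f" "x \<in> S"
  shows "frechet_derivative (\<lambda>z. frechet_derivative f (at z) u) (at x) v
       = frechet_derivative (\<lambda>z. frechet_derivative f (at z) v) (at x) u"
proof -
  note smooth' = smooth_on_frechet_derivative[OF assms(1,2)]
  have comp: "frechet_derivative (\<lambda>z. frechet_derivative f (at z) u) (at x) v $ i
      = frechet_derivative (\<lambda>z. frechet_derivative (\<lambda>z. f z $ i) (at z) u) (at x) v" for u v i
  proof -
    have "frechet_derivative (\<lambda>z. frechet_derivative f (at z) u) (at x) v $ i
        = frechet_derivative (\<lambda>z. frechet_derivative f (at z) u $ i) (at x) v"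
      by (rule frechet_derivative_bounded_linear_comp[OF bounded_linear_vec_nth
            smooth_on_differentiable[OF smooth' assms(3)], symmetric])
    also have "\<dots> = frechet_derivative (\<lambda>z. frechet_derivative (\<lambda>z. f z $ i) (at z) u) (at x) v"
    proof (rule fun_cong[OF frechet_derivative_transform_within_open])
      show "(\<lambda>z. frechet_derivative f (at z) u $ i) differentiable (at x)"
        by (rule smooth_on_differentiable[OF smooth_on_bounded_linear_comp[OF bounded_linear_vec_nth smooth'] assms(3)])
      show "frechet_derivative f (at z) u $ i = frechet_derivative (\<lambda>z. f z $ i) (at z) u" if "z \<in> S" for z
        by (rule frechet_derivative_bounded_linear_comp[OF bounded_linear_vec_nth
              smooth_on_differentiable[OF assms(2) that], symmetric])
    qed (use assms in simp_all)
    finally show ?thesis .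
  qed
  have "smooth_on S (\<lambda>z. f z $ i)" for i
    by (rule smooth_on_bounded_linear_comp[OF bounded_linear_vec_nth assms(2)])
  then show ?thesis
    by (simp add: vec_eq_iff comp order_antisym mixed_derivatives_le[OF assms(1) _ assms(3)])
qed


section \<open>Pairs of vectors\<close>

text \<open>In an induced chart of the tangent bundle, \<open>hpart\<close> and \<open>vpart\<close> extract the coordinates
  $x^i$ and $y^i$, or the corresponding components of a vector tangent to the bundle.\<close>

definition join_vec :: "real^'n \<Rightarrow> real^'n \<Rightarrow> real^('n::finite + 'n)" where
  "join_vec x w = (\<chi> a. case a of Inl i \<Rightarrow> x $ i | Inr i \<Rightarrow> w $ i)"

definition hpart :: "real^('n::finite + 'n) \<Rightarrow> real^'n" where
  "hpart z = (\<chi> i. z $ Inl i)"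

definition vpart :: "real^('n::finite + 'n) \<Rightarrow> real^'n" where
  "vpart z = (\<chi> i. z $ Inr i)"

lemma join_vec_nth [simp]: "join_vec x w $ Inl i = x $ i" "join_vec x w $ Inr i = w $ i"
  by (simp_all add: join_vec_def)

lemma parts_nth [simp]: "hpart z $ i = z $ Inl i" "vpart z $ i = z $ Inr i"
  by (simp_all add: hpart_def vpart_def)

lemma parts_join_vec [simp]: "hpart (join_vec x w) = x" "vpart (join_vec x w) = w"
  by (simp_all add: vec_eq_iff)

lemma vec_sum_eq_iff: "z = z' \<longleftrightarrow> (\<forall>i. z $ Inl i = z' $ Inl i) \<and> (\<forall>i. z $ Inr i = z' $ Inr i)"
  for z z' :: "'a^('n::finite + 'n)"
  by (metis sum.exhaust_sel vec_eq_iff)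

lemma join_vec_parts [simp]: "join_vec (hpart z) (vpart z) = z"
  by (simp add: vec_sum_eq_iff)

lemma bounded_linear_hpart: "bounded_linear hpart"
  by (simp add: linear_conv_bounded_linear[symmetric] linear_iff vec_eq_iff)

lemma bounded_linear_vpart: "bounded_linear vpart"
  by (simp add: linear_conv_bounded_linear[symmetric] linear_iff vec_eq_iff)

lemma bounded_linear_join_vec_0: "bounded_linear (\<lambda>x. join_vec x 0)"
  by (simp add: linear_conv_bounded_linear[symmetric] linear_iff vec_sum_eq_iff)

lemma bounded_linear_join_vec_0': "bounded_linear (join_vec 0)"
  by (simp add: linear_conv_bounded_linear[symmetric] linear_iff vec_sum_eq_iff)

lemma join_vec_add: "join_vec x w + join_vec x' w' = join_vec (x + x') (w + w')"
  by (simp add: vec_sum_eq_iff)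

lemma axis_Inl: "axis (Inl i) 1 = join_vec (axis i 1) 0"
  by (simp add: vec_sum_eq_iff axis_def)

lemma axis_Inr: "axis (Inr i) 1 = join_vec 0 (axis i 1)"
  by (simp add: vec_sum_eq_iff axis_def)

lemma sum_UNIV_sum:
  fixes f :: "'a::finite + 'b::finite \<Rightarrow> 'c::comm_monoid_add"
  shows "(\<Sum>a\<in>UNIV. f a) = (\<Sum>i\<in>UNIV. f (Inl i)) + (\<Sum>i\<in>UNIV. f (Inr i))"
proof -
  have "sum f (Inl ` UNIV \<union> Inr ` UNIV) = sum f (Inl ` UNIV) + sum f (Inr ` UNIV)"
    by (rule sum.union_disjoint) auto
  then show ?thesis
    by (simp add: UNIV_sum sum.reindex inj_on_def)
qed


section \<open>Matrices\<close>

lemma positive_definite_invertible: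
  fixes M :: "real^'n::finite^'n"
  assumes "\<And>x. x \<noteq> 0 \<Longrightarrow> x \<bullet> (M *v x) > 0"
  shows "invertible M"
proof -
  have "x = 0" if "M *v x = 0" for x
    using assms[of x] that by auto
  then show ?thesis
    by (auto simp: invertible_left_inverse matrix_left_invertible_ker)
qed

lemma matrix_inv_invertible:
  fixes M :: "real^'n::finite^'n"
  assumes "invertible M"
  shows "M ** matrix_inv M = mat 1" "matrix_inv M ** M = mat 1"
  using someI_ex[OF assms[unfolded invertible_def]] by (simp_all add: matrix_inv_def)

lemma matrix_inv_mult_eq_iff:
  fixes M :: "real^'n::finite^'n"
  assumes "invertible M"
  shows "matrix_inv M *v b = x \<longleftrightarrow> M *v x = b"
  using matrix_inv_invertible[OF assms] by (metis matrix_vector_mul_assoc matrix_vector_mul_lid)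

lemma differentiable_finite_prod:
  fixes f :: "'i \<Rightarrow> 'a::real_normed_vector \<Rightarrow> real"
  shows "(\<And>i. i \<in> I \<Longrightarrow> f i differentiable (at x)) \<Longrightarrow> (\<lambda>x. \<Prod>i\<in>I. f i x) differentiable (at x)"
  by (induction I rule: infinite_finite_induct) auto

lemma differentiable_det:
  fixes M :: "'a::real_normed_vector \<Rightarrow> real^'n::finite^'n"
  assumes "\<And>i j. (\<lambda>x. M x $ i $ j) differentiable (at x)"
  shows "(\<lambda>x. det (M x)) differentiable (at x)"
  unfolding det_def by (intro differentiable_sum differentiable_mult differentiable_finite_prod ballI assms) auto

lemma differentiable_transform_open:
  assumes "f differentiable (at x)" "open S" "x \<in> S" "\<And>y. y \<in> S \<Longrightarrow> f y = g y"
  shows "g differentiable (at x)"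
  using assms has_derivative_transform_within_open[OF _ assms(2,3)] unfolding differentiable_def by blast

text \<open>Cramer's rule exhibits the inverse as a rational function of the entries.\<close>

lemma differentiable_matrix_inv_mult:
  fixes M :: "'a::real_normed_vector \<Rightarrow> real^'n::finite^'n"
  assumes "open S" "x \<in> S" "\<And>y. y \<in> S \<Longrightarrow> invertible (M y)"
    and M: "\<And>i j. (\<lambda>x. M x $ i $ j) differentiable (at x)" and b: "\<And>i. (\<lambda>x. b x $ i) differentiable (at x)"
  shows "(\<lambda>x. (matrix_inv (M x) *v b x) $ k) differentiable (at x)"
proof (rule differentiable_transform_open[OF _ assms(1,2)])
  have "(\<lambda>y. (\<chi> i j. if j = k then b y $ i else M y $ i $ j) $ i $ j) differentiable (at x)" for i j
    using M b by (cases "j = k") auto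
  then show "(\<lambda>y. det (\<chi> i j. if j = k then b y $ i else M y $ i $ j) / det (M y)) differentiable (at x)"
    using assms(2,3) by (intro differentiable_divide differentiable_det M) (simp_all add: invertible_det_nz)
  show "det (\<chi> i j. if j = k then b y $ i else M y $ i $ j) / det (M y) = (matrix_inv (M y) *v b y) $ k"
    if "y \<in> S" for y
  proof -
    have "M y *v (matrix_inv (M y) *v b y) = b y"
      using matrix_inv_mult_eq_iff[OF assms(3)[OF that]] by blast
    moreover have "det (M y) \<noteq> 0"
      using assms(3)[OF that] by (simp add: invertible_det_nz)
    ultimately show ?thesis
      using cramer[of "M y" "matrix_inv (M y) *v b y" "b y"] by (metis (no_types, lifting) vec_lambda_beta)
  qed
qed


section \<open>Tangent vectors and metrics in a chart\<close>

lemma chart_inv_in [simp]: "x \<in> snd c ` fst c \<Longrightarrow> chart_inv c x \<in> fst c"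
  by (simp add: chart_inv_def inv_into_into)

lemma chart_chart_inv [simp]: "x \<in> snd c ` fst c \<Longrightarrow> snd c (chart_inv c x) = x"
  by (simp add: chart_inv_def f_inv_into_f)

context
  fixes B :: "('q, 'm::finite) chart set"
  assumes atlas: "smooth_atlas B"
begin

lemma chart_inj: "c \<in> B \<Longrightarrow> inj_on (snd c) (fst c)"
  and chart_open: "c \<in> B \<Longrightarrow> open (snd c ` fst c)"
  and chart_open_Int: "c \<in> B \<Longrightarrow> c' \<in> B \<Longrightarrow> open (snd c ` (fst c \<inter> fst c'))"
  and transition_smooth: "c \<in> B \<Longrightarrow> c' \<in> B \<Longrightarrow> smooth_on (snd c ` (fst c \<inter> fst c')) (snd c' \<circ> chart_inv c)"
  using atlas by (auto simp: smooth_atlas_def)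

lemma chart_inv_chart: "c \<in> B \<Longrightarrow> p \<in> fst c \<Longrightarrow> chart_inv c (snd c p) = p"
  by (simp add: chart_inv_def chart_inj)

lemma transition_has_derivative:
  assumes "c \<in> B" "c' \<in> B" "p \<in> fst c" "p \<in> fst c'"
  shows "((snd c' \<circ> chart_inv c) has_derivative transition_deriv c c' p) (at (snd c p))"
proof -
  have "(snd c' \<circ> chart_inv c) differentiable (at (snd c p))"
    by (rule smooth_on_differentiable[OF transition_smooth]) (use assms in auto)
  then show ?thesis
    by (simp add: transition_deriv_def frechet_derivative_works[symmetric])
qed

lemma bounded_linear_transition_deriv:
  assumes "c \<in> B" "c' \<in> B" "p \<in> fst c" "p \<in> fst c'"
  shows "bounded_linear (transition_deriv c c' p)"
  using transition_has_derivative[OF assms] by (rule has_derivative_bounded_linear)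

lemma transition_deriv_self:
  assumes "c \<in> B" "p \<in> fst c"
  shows "transition_deriv c c p w = w"
proof -
  have "((\<lambda>x. x) has_derivative (\<lambda>x. x)) (at (snd c p))"
    by (rule has_derivative_ident)
  then have "((snd c \<circ> chart_inv c) has_derivative (\<lambda>x. x)) (at (snd c p))"
    by (rule has_derivative_transform_within_open[of _ _ _ _ "snd c ` fst c"])
      (use assms chart_open in auto)
  with transition_has_derivative[OF assms(1) assms(1) assms(2) assms(2)]
  have "transition_deriv c c p = (\<lambda>x. x)"
    by (rule has_derivative_unique)
  then show ?thesis
    by simp
qed

text \<open>The chain rule for transition maps. It makes the tangent vector with prescribed
  components in one chart consistent in all charts.\<close>

lemma transition_deriv_comp:
  assumes "c \<in> B" "c' \<in> B" "c'' \<in> B" "p \<in> fst c" "p \<in> fst c'" "p \<in> fst c''"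
  shows "transition_deriv c' c'' p (transition_deriv c c' p w) = transition_deriv c c'' p w"
proof -
  have "((snd c'' \<circ> chart_inv c') has_derivative transition_deriv c' c'' p)
      (at ((snd c' \<circ> chart_inv c) (snd c p)))"
    using transition_has_derivative[OF assms(2,3,5,6)] assms by (simp add: chart_inv_chart)
  from diff_chain_at[OF transition_has_derivative[OF assms(1,2,4,5)] this]
  have "((snd c'' \<circ> chart_inv c) has_derivative (transition_deriv c' c'' p \<circ> transition_deriv c c' p)) (at (snd c p))"
    by (rule has_derivative_transform_within_open[of _ _ _ _ "snd c ` (fst c \<inter> fst c')"])
      (use assms chart_open_Int in \<open>auto simp: chart_inv_chart\<close>)
  with transition_has_derivative[OF assms(1,3,4,6)]
  have "transition_deriv c c'' p = transition_deriv c' c'' p \<circ> transition_deriv c c' p"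
    by (intro has_derivative_unique)
  then show ?thesis
    by simp
qed

lemma tangent_space_transition:
  assumes "v \<in> tangent_space B p" "c \<in> B" "c' \<in> B" "p \<in> fst c" "p \<in> fst c'"
  shows "v c' = transition_deriv c c' p (v c)"
proof -
  from assms(1) have "\<forall>c\<in>B. \<forall>c'\<in>B. p \<in> fst c \<and> p \<in> fst c' \<longrightarrow> v c' = transition_deriv c c' p (v c)"
    unfolding tangent_space_def by (elim CollectE conjE)
  then show ?thesis
    using assms(2-5) by blast
qed

lemma tangent_space_zero: "v \<in> tangent_space B p \<Longrightarrow> \<not> (c \<in> B \<and> p \<in> fst c) \<Longrightarrow> v c = 0"
  unfolding tangent_space_def by blast

lemma tangent_vector_in:
  assumes "c \<in> B" "p \<in> fst c"
  shows "tangent_vector B c p w \<in> tangent_space B p"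
  using assms transition_deriv_comp by (simp add: tangent_space_def tangent_vector_def)

lemma tangent_vector_component [simp]:
  "c \<in> B \<Longrightarrow> p \<in> fst c \<Longrightarrow> tangent_vector B c p w c = w"
  by (simp add: tangent_vector_def transition_deriv_self)

lemma tangent_vector_of_component:
  assumes "c \<in> B" "p \<in> fst c" "v \<in> tangent_space B p"
  shows "tangent_vector B c p (v c) = v"
proof
  fix C show "tangent_vector B c p (v c) C = v C"
    using tangent_space_transition[OF assms(3,1) _ assms(2), of C] tangent_space_zero[OF assms(3), of C]
    by (cases "C \<in> B \<and> p \<in> fst C") (auto simp: tangent_vector_def)
qed

text \<open>One chart determines a tangent vector, so identities between tangent vectors reduce to
  identities between components.\<close>

lemma tangent_space_eqI:
  assumes "c \<in> B" "p \<in> fst c" "u \<in> tangent_space B p" "v \<in> tangent_space B p" "u c = v c"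
  shows "u = v"
  using tangent_vector_of_component[OF assms(1,2)] assms(3-5) by metis

lemma tangent_space_sum:
  assumes "\<And>i. i \<in> I \<Longrightarrow> u i \<in> tangent_space B p"
  shows "(\<lambda>c. \<Sum>i\<in>I. a i *\<^sub>R u i c) \<in> tangent_space B p"
proof -
  have "(\<Sum>i\<in>I. a i *\<^sub>R u i c') = transition_deriv c c' p (\<Sum>i\<in>I. a i *\<^sub>R u i c)"
    if "c \<in> B" "c' \<in> B" "p \<in> fst c" "p \<in> fst c'" for c c'
  proof -
    have "linear (transition_deriv c c' p)"
      using bounded_linear_transition_deriv[OF that] by (rule bounded_linear.linear)
    moreover have "u i c' = transition_deriv c c' p (u i c)" if "i \<in> I" for i
      by (rule tangent_space_transition[OF assms[OF that]]) fact+
    ultimately show ?thesis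
      by (simp add: linear_sum linear_cmul cong: sum.cong)
  qed
  moreover have "(\<Sum>i\<in>I. a i *\<^sub>R u i c) = 0" if "\<not> (c \<in> B \<and> p \<in> fst c)" for c
    using tangent_space_zero[OF assms that] by (intro sum.neutral) simp
  ultimately show ?thesis
    unfolding tangent_space_def by blast
qed

lemma coord_vector_in: "c \<in> B \<Longrightarrow> p \<in> fst c \<Longrightarrow> coord_vector B c i p \<in> tangent_space B p"
  by (simp add: coord_vector_def tangent_vector_in)

lemma coord_vector_component [simp]:
  "c \<in> B \<Longrightarrow> p \<in> fst c \<Longrightarrow> coord_vector B c i p c = axis i 1"
  by (simp add: coord_vector_def)

lemma tangent_space_expand:
  assumes "c \<in> B" "p \<in> fst c" "v \<in> tangent_space B p"
  shows "v = (\<lambda>C. \<Sum>i\<in>UNIV. v c $ i *\<^sub>R coord_vector B c i p C)"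
proof (rule tangent_space_eqI[OF assms])
  show "(\<lambda>C. \<Sum>i\<in>UNIV. v c $ i *\<^sub>R coord_vector B c i p C) \<in> tangent_space B p"
    by (intro tangent_space_sum coord_vector_in assms)
  show "v c = (\<Sum>i\<in>UNIV. v c $ i *\<^sub>R coord_vector B c i p c)"
    using basis_expansion[of "v c"] assms by (simp add: scalar_mult_eq_scaleR)
qed

lemma partial_deriv_chart:
  assumes "c \<in> B" "x \<in> snd c ` fst c"
  shows "partial_deriv c i F (chart_inv c x) = frechet_derivative (F \<circ> chart_inv c) (at x) (axis i 1)"
  using assms by (simp add: partial_deriv_def)

lemma smooth_on_partial_deriv:
  assumes "c \<in> B" "smooth_on (snd c ` fst c) (\<lambda>x. F (chart_inv c x))"
  shows "smooth_on (snd c ` fst c) (\<lambda>x. partial_deriv c i F (chart_inv c x))"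
proof (rule smooth_on_cong[OF chart_open[OF assms(1)]])
  show "smooth_on (snd c ` fst c) (\<lambda>x. frechet_derivative (F \<circ> chart_inv c) (at x) (axis i 1))"
    using assms by (intro smooth_on_frechet_derivative chart_open) (simp_all add: comp_def)
qed (simp add: partial_deriv_chart[OF assms(1)])


context
  fixes H :: "('q, 'm) metric"
  assumes metric: "riemannian_metric B H"
begin

lemma metric_sym:
  "p \<in> points B \<Longrightarrow> u \<in> tangent_space B p \<Longrightarrow> v \<in> tangent_space B p \<Longrightarrow> H p u v = H p v u"
  using metric by (simp add: riemannian_metric_def)

lemma metric_pos:
  "p \<in> points B \<Longrightarrow> u \<in> tangent_space B p \<Longrightarrow> u \<noteq> (\<lambda>_. 0) \<Longrightarrow> H p u u > 0"
  using metric by (simp add: riemannian_metric_def)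

lemma metric_linear:
  "p \<in> points B \<Longrightarrow> u \<in> tangent_space B p \<Longrightarrow> v \<in> tangent_space B p \<Longrightarrow> w \<in> tangent_space B p \<Longrightarrow>
    H p (\<lambda>c. a *\<^sub>R u c + b *\<^sub>R v c) w = a * H p u w + b * H p v w"
  using metric by (simp add: riemannian_metric_def)

lemma metric_sum:
  assumes "p \<in> points B" "finite I" "\<And>i. i \<in> I \<Longrightarrow> u i \<in> tangent_space B p" "w \<in> tangent_space B p"
  shows "H p (\<lambda>c. \<Sum>i\<in>I. a i *\<^sub>R u i c) w = (\<Sum>i\<in>I. a i * H p (u i) w)"
  using assms(2,3)
proof (induction I rule: finite_induct)
  case empty
  show ?case
    using metric_linear[OF assms(1,4,4,4), of 0 0] by simp
next
  case (insert i I)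
  then have "(\<lambda>c. \<Sum>i\<in>I. a i *\<^sub>R u i c) \<in> tangent_space B p"
    by (intro tangent_space_sum) auto
  from metric_linear[OF assms(1) _ this assms(4), of "u i" "a i" 1] insert show ?case
    by simp
qed

lemma metric_coeff_sym:
  "c \<in> B \<Longrightarrow> p \<in> fst c \<Longrightarrow> metric_coeff B H c i j p = metric_coeff B H c j i p"
  by (simp add: metric_coeff_def metric_sym coord_vector_in points_def bexI[of _ c])

lemma metric_eq_coeff:
  assumes "c \<in> B" "p \<in> fst c" "u \<in> tangent_space B p" "v \<in> tangent_space B p"
  shows "H p u v = (\<Sum>i\<in>UNIV. \<Sum>j\<in>UNIV. u c $ i * v c $ j * metric_coeff B H c i j p)"
proof -
  have p: "p \<in> points B"
    using assms by (auto simp: points_def)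
  note e = coord_vector_in[OF assms(1,2)]
  have expand: "H p u w = (\<Sum>i\<in>UNIV. u c $ i * H p (coord_vector B c i p) w)"
    if "u \<in> tangent_space B p" "w \<in> tangent_space B p" for u w
  proof -
    have "H p (\<lambda>C. \<Sum>i\<in>UNIV. u c $ i *\<^sub>R coord_vector B c i p C) w
        = (\<Sum>i\<in>UNIV. u c $ i * H p (coord_vector B c i p) w)"
      by (rule metric_sum[OF p finite e that(2)])
    then show ?thesis
      by (simp add: tangent_space_expand[OF assms(1,2) that(1), symmetric])
  qed
  have "H p (coord_vector B c i p) v = (\<Sum>j\<in>UNIV. v c $ j * metric_coeff B H c i j p)" for i
    using expand[OF assms(4) e] metric_sym[OF p e assms(4)] metric_sym[OF p e e] by (simp add: metric_coeff_def)
  then show ?thesis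
    by (simp add: expand[OF assms(3,4)] sum_distrib_left mult.assoc)
qed

lemma metric_matrix_invertible:
  assumes "c \<in> B" "p \<in> fst c"
  shows "invertible (\<chi> i j. metric_coeff B H c i j p)"
proof (rule positive_definite_invertible)
  fix x :: "real^'m" assume "x \<noteq> 0"
  have p: "p \<in> points B"
    using assms by (auto simp: points_def)
  define u where "u = tangent_vector B c p x"
  have u: "u \<in> tangent_space B p" "u c = x"
    using assms by (simp_all add: u_def tangent_vector_in)
  have "H p u u > 0"
    using u \<open>x \<noteq> 0\<close> by (intro metric_pos p) auto
  also have "H p u u = x \<bullet> ((\<chi> i j. metric_coeff B H c i j p) *v x)"
    by (simp add: metric_eq_coeff[OF assms u(1) u(1)] u(2) inner_vec_def matrix_vector_mult_def
        sum_distrib_left mult_ac)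
  finally show "x \<bullet> ((\<chi> i j. metric_coeff B H c i j p) *v x) > 0" .
qed

text \<open>The Christoffel symbol of the first kind, with lowered index \<open>l\<close>.\<close>

definition christoffel1 :: "('q, 'm) chart \<Rightarrow> 'm \<Rightarrow> 'm \<Rightarrow> 'm \<Rightarrow> 'q \<Rightarrow> real" where
  "christoffel1 c l k i p =
     (partial_deriv c k (metric_coeff B H c l i) p + partial_deriv c i (metric_coeff B H c l k) p
      - partial_deriv c l (metric_coeff B H c k i) p) / 2"

lemma christoffel_eq:
  "christoffel B H c h k i p
     = (matrix_inv (\<chi> a b. metric_coeff B H c a b p) *v (\<chi> l. christoffel1 c l k i p)) $ h"
  by (simp add: christoffel_def christoffel1_def matrix_vector_mult_def sum_divide_distrib)

text \<open>Christoffel symbols are recognised after lowering the upper index. This avoids inverting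
  the metric matrix, which for \<open>G\<close> on the zero section is a block matrix with the
  blocks \<open>c\<^sub>i(0) g\<close>.\<close>

lemma christoffel_eqI:
  assumes "c \<in> B" "p \<in> fst c"
    and "\<And>l. (\<Sum>h\<in>UNIV. metric_coeff B H c l h p * \<gamma> h) = christoffel1 c l k i p"
  shows "christoffel B H c h k i p = \<gamma> h"
proof -
  have "(\<chi> a b. metric_coeff B H c a b p) *v (\<chi> h. \<gamma> h) = (\<chi> l. christoffel1 c l k i p)"
    using assms(3) by (simp add: vec_eq_iff matrix_vector_mult_def)
  then have "matrix_inv (\<chi> a b. metric_coeff B H c a b p) *v (\<chi> l. christoffel1 c l k i p) = (\<chi> h. \<gamma> h)"
    using matrix_inv_mult_eq_iff[OF metric_matrix_invertible[OF assms(1,2)]] by blast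
  then show ?thesis
    by (simp add: christoffel_eq)
qed

lemma christoffel_lower:
  assumes "c \<in> B" "p \<in> fst c"
  shows "(\<Sum>h\<in>UNIV. metric_coeff B H c l h p * christoffel B H c h k i p) = christoffel1 c l k i p"
proof -
  let ?v = "matrix_inv (\<chi> a b. metric_coeff B H c a b p) *v (\<chi> l. christoffel1 c l k i p)"
  have "(\<chi> a b. metric_coeff B H c a b p) *v ?v = (\<chi> l. christoffel1 c l k i p)"
    using matrix_inv_mult_eq_iff[OF metric_matrix_invertible[OF assms]] by blast
  from arg_cong[OF this, of "\<lambda>w. w $ l"] show ?thesis
    by (simp add: christoffel_eq matrix_vector_mult_def)
qed

lemma metric_coeff_smooth:
  "c \<in> B \<Longrightarrow> smooth_on (snd c ` fst c) (\<lambda>x. metric_coeff B H c i j (chart_inv c x))"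
  using metric by (simp add: riemannian_metric_def)

lemma metric_coeff_sym_partial:
  assumes "c \<in> B" "p \<in> fst c"
  shows "partial_deriv c k (metric_coeff B H c i j) p = partial_deriv c k (metric_coeff B H c j i) p"
proof -
  have x: "snd c p \<in> snd c ` fst c"
    using assms by blast
  have "frechet_derivative (metric_coeff B H c i j \<circ> chart_inv c) (at (snd c p))
      = frechet_derivative (metric_coeff B H c j i \<circ> chart_inv c) (at (snd c p))"
    by (rule frechet_derivative_transform_within_open[OF _ chart_open[OF assms(1)] x])
      (use smooth_on_differentiable[OF metric_coeff_smooth[OF assms(1)] x] metric_coeff_sym[OF assms(1)]
        in \<open>auto simp: comp_def\<close>)
  then show ?thesis
    by (simp add: partial_deriv_def)
qed

lemma christoffel_differentiable:
  assumes "c \<in> B" "x \<in> snd c ` fst c"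
  shows "(\<lambda>x. christoffel B H c h k i (chart_inv c x)) differentiable (at x)"
  unfolding christoffel_eq
proof (rule differentiable_matrix_inv_mult[OF chart_open[OF assms(1)] assms(2)])
  show "invertible (\<chi> a b. metric_coeff B H c a b (chart_inv c y))" if "y \<in> snd c ` fst c" for y
    using that assms by (intro metric_matrix_invertible) simp_all
  show "(\<lambda>x. (\<chi> a b. metric_coeff B H c a b (chart_inv c x)) $ i $ j) differentiable (at x)" for i j
    using smooth_on_differentiable[OF metric_coeff_smooth[OF assms(1)] assms(2)] by simp
  have "(\<lambda>x. partial_deriv c k (metric_coeff B H c i j) (chart_inv c x)) differentiable (at x)" for i j k
    by (rule smooth_on_differentiable[OF smooth_on_partial_deriv[OF assms(1) metric_coeff_smooth] assms(2)]) (rule assms)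
  then show "(\<lambda>x. (\<chi> l. christoffel1 c l k i (chart_inv c x)) $ l) differentiable (at x)" for l
    by (simp add: christoffel1_def)
qed

end

lemma vector_field_component_smooth:
  assumes "vector_field B X" "c \<in> B"
  shows "smooth_on (snd c ` fst c) (\<lambda>x. X (chart_inv c x) c $ h)"
  using assms by (intro smooth_on_bounded_linear_comp[OF bounded_linear_vec_nth]) (simp add: vector_field_def)

text \<open>A second covariant derivative along a submanifold can be computed from the restriction of
  the first one only if the first one is differentiable in all directions. This is
  guaranteed here.\<close>

lemma levi_civita_differentiable:
  assumes "riemannian_metric B H" "c \<in> B" "x \<in> snd c ` fst c" "vector_field B X" "vector_field B Y"
  shows "(\<lambda>x. levi_civita B H X Y (chart_inv c x) c $ h) differentiable (at x)"
proof (rule differentiable_transform_open[OF _ chart_open[OF assms(2)] assms(3)])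
  note X = smooth_on_differentiable[OF vector_field_component_smooth[OF assms(4,2)] assms(3)]
  note Y = smooth_on_differentiable[OF vector_field_component_smooth[OF assms(5,2)] assms(3)]
  note Y' = smooth_on_differentiable[OF smooth_on_partial_deriv[OF assms(2)
      vector_field_component_smooth[OF assms(5,2)]] assms(3)]
  show "(\<lambda>x. (\<Sum>i\<in>UNIV. X (chart_inv c x) c $ i * partial_deriv c i (\<lambda>q. Y q c $ h) (chart_inv c x))
      + (\<Sum>i\<in>UNIV. \<Sum>k\<in>UNIV. christoffel B H c h i k (chart_inv c x) * X (chart_inv c x) c $ i * Y (chart_inv c x) c $ k))
      differentiable (at x)"
    by (intro differentiable_add differentiable_sum differentiable_mult ballI X Y Y'
        christoffel_differentiable[OF assms(1-3)]) simp_all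
qed (use assms in \<open>auto simp: levi_civita_def\<close>)

end


section \<open>The tangent map of a smooth map\<close>

lemmas has_frechet_derivative = frechet_derivative_works[THEN iffD1]

text \<open>The tangent map \<open>(x, y) \<mapsto> (f(x), Df(x) y)\<close> plays two roles. Applied to the transition maps of the
  base it gives the transition maps of the tangent bundle. Applied to the component function of a
  vector field it gives the components of the complete lift of this field.\<close>

definition tangent_map :: "(real^'n \<Rightarrow> real^'n) \<Rightarrow> real^('n::finite + 'n) \<Rightarrow> real^('n + 'n)" where
  "tangent_map f z = join_vec (f (hpart z)) (frechet_derivative f (at (hpart z)) (vpart z))"

lemma open_vimage_hpart: "open S \<Longrightarrow> open (hpart -` S)"
  by (rule open_vimage) (auto intro: linear_continuous_on bounded_linear_hpart)

lemma linear_vec_expand: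
  fixes f :: "real^'n::finite \<Rightarrow> 'b::real_vector"
  assumes "linear f"
  shows "f w = (\<Sum>k\<in>UNIV. w $ k *\<^sub>R f (axis k 1))"
proof -
  have "w = (\<Sum>k\<in>UNIV. w $ k *\<^sub>R axis k 1)"
    using basis_expansion[of w] by (simp add: scalar_mult_eq_scaleR)
  then have "f w = f (\<Sum>k\<in>UNIV. w $ k *\<^sub>R axis k 1)"
    by simp
  then show ?thesis
    by (simp add: linear_sum[OF assms] linear_cmul[OF assms])
qed

lemma tangent_map_expand:
  assumes "f differentiable (at (hpart z))"
  shows "tangent_map f z = join_vec (f (hpart z)) 0
    + (\<Sum>k\<in>UNIV. (vpart z $ k) *\<^sub>R join_vec 0 (frechet_derivative f (at (hpart z)) (axis k 1)))"
proof -
  have lin: "linear (\<lambda>w. join_vec 0 (frechet_derivative f (at (hpart z)) w))"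
    using linear_compose[OF linear_frechet_derivative[OF assms]
        bounded_linear.linear[OF bounded_linear_join_vec_0']] by (simp add: comp_def)
  show ?thesis
    unfolding tangent_map_def linear_vec_expand[OF lin, of "vpart z", symmetric] join_vec_add by simp
qed

lemma smooth_on_tangent_map:
  assumes "open S" "smooth_on S f"
  shows "smooth_on (hpart -` S) (tangent_map f)"
proof (rule smooth_on_cong[OF open_vimage_hpart[OF assms(1)]])
  have hp: "hpart ` (hpart -` S) \<subseteq> S"
    by auto
  show "smooth_on (hpart -` S) (\<lambda>z. join_vec (f (hpart z)) 0
    + (\<Sum>k\<in>UNIV. (vpart z $ k) *\<^sub>R join_vec 0 (frechet_derivative f (at (hpart z)) (axis k 1))))"
    by (intro smooth_on_add smooth_on_sum smooth_on_scaleR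
        smooth_on_bounded_linear_comp[OF bounded_linear_join_vec_0]
        smooth_on_bounded_linear_comp[OF bounded_linear_join_vec_0']
        smooth_on_bounded_linear_comp[OF bounded_linear_vec_nth]
        smooth_on_bounded_linear[OF bounded_linear_vpart]
        smooth_on_comp_bounded_linear[OF bounded_linear_hpart hp] assms
        smooth_on_comp_bounded_linear[OF bounded_linear_hpart hp, of "\<lambda>x. frechet_derivative f (at x) _"]
        smooth_on_frechet_derivative)
qed (rule tangent_map_expand[OF smooth_on_differentiable[OF assms(2)], symmetric], simp)

lemma tangent_map_has_derivative:
  fixes f :: "real^'n::finite \<Rightarrow> real^'n"
  assumes "open S" "smooth_on S f" "x \<in> S"
  shows "(tangent_map f has_derivative (\<lambda>d. join_vec (frechet_derivative f (at x) (hpart d))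
      (frechet_derivative (\<lambda>x. frechet_derivative f (at x) w) (at x) (hpart d)
        + frechet_derivative f (at x) (vpart d)))) (at (join_vec x w))"
proof -
  let ?D = "frechet_derivative f (at x)"
  let ?E = "\<lambda>k. frechet_derivative (\<lambda>x. frechet_derivative f (at x) (axis k 1)) (at x)"
  have df: "f differentiable (at y)" if "y \<in> S" for y
    using smooth_on_differentiable[OF assms(2) that] .
  have d2f: "(\<lambda>x. frechet_derivative f (at x) v) differentiable (at x)" for v
    using smooth_on_differentiable[OF smooth_on_frechet_derivative[OF assms(1,2)] assms(3)] .
  have D1: "(f has_derivative ?D) (at (hpart (join_vec x w)))"
    by (simp add: has_frechet_derivative[OF df[OF assms(3)]])
  have D2: "((\<lambda>x. frechet_derivative f (at x) (axis k 1)) has_derivative ?E k) (at (hpart (join_vec x w)))" for k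
    by (simp add: has_frechet_derivative[OF d2f])
  note hp = bounded_linear_imp_has_derivative[OF bounded_linear_hpart]
  have vp: "((\<lambda>z. vpart z $ k) has_derivative (\<lambda>d. vpart d $ k)) F" for k F
    by (intro bounded_linear.has_derivative[OF bounded_linear_vec_nth]
        bounded_linear_imp_has_derivative[OF bounded_linear_vpart])
  have "((\<lambda>z. join_vec (f (hpart z)) 0
      + (\<Sum>k\<in>UNIV. (vpart z $ k) *\<^sub>R join_vec 0 (frechet_derivative f (at (hpart z)) (axis k 1))))
    has_derivative (\<lambda>d. join_vec (?D (hpart d)) 0
      + (\<Sum>k\<in>UNIV. (vpart (join_vec x w) $ k) *\<^sub>R join_vec 0 (?E k (hpart d))
          + (vpart d $ k) *\<^sub>R join_vec 0 (frechet_derivative f (at (hpart (join_vec x w))) (axis k 1)))))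
    (at (join_vec x w))"
    by (intro has_derivative_add has_derivative_sum has_derivative_scaleR vp
        bounded_linear.has_derivative[OF bounded_linear_join_vec_0]
        bounded_linear.has_derivative[OF bounded_linear_join_vec_0']
        has_derivative_compose[OF hp D1] has_derivative_compose[OF hp D2])
  then have "(tangent_map f has_derivative (\<lambda>d. join_vec (?D (hpart d)) 0
      + (\<Sum>k\<in>UNIV. (vpart (join_vec x w) $ k) *\<^sub>R join_vec 0 (?E k (hpart d))
          + (vpart d $ k) *\<^sub>R join_vec 0 (frechet_derivative f (at (hpart (join_vec x w))) (axis k 1)))))
    (at (join_vec x w))"
    by (rule has_derivative_transform_within_open[OF _ open_vimage_hpart[OF assms(1)]])
      (simp add: assms(3), rule tangent_map_expand[OF df, symmetric], simp)
  then show ?thesis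
  proof (rule has_derivative_eq_rhs, intro ext)
    fix d :: "real^('n + 'n)"
    \<comment> \<open>Symmetry of the second derivative turns the sum over the basis into a directional derivative.\<close>
    have "(\<Sum>k\<in>UNIV. w $ k *\<^sub>R ?E k (hpart d))
        = (\<Sum>k\<in>UNIV. w $ k *\<^sub>R frechet_derivative (\<lambda>x. frechet_derivative f (at x) (hpart d)) (at x) (axis k 1))"
      by (simp add: mixed_derivatives_eq[OF assms, of _ "hpart d"])
    also have "\<dots> = frechet_derivative (\<lambda>x. frechet_derivative f (at x) (hpart d)) (at x) w"
      by (rule linear_vec_expand[OF linear_frechet_derivative[OF d2f], symmetric])
    also have "\<dots> = frechet_derivative (\<lambda>x. frechet_derivative f (at x) w) (at x) (hpart d)"
      by (rule mixed_derivatives_eq[OF assms])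
    finally have 1: "(\<Sum>k\<in>UNIV. w $ k *\<^sub>R ?E k (hpart d))
      = frechet_derivative (\<lambda>x. frechet_derivative f (at x) w) (at x) (hpart d)" .
    have 2: "(\<Sum>k\<in>UNIV. vpart d $ k *\<^sub>R ?D (axis k 1)) = ?D (vpart d)"
      by (rule linear_vec_expand[OF linear_frechet_derivative[OF df[OF assms(3)]], symmetric])
    have "linear (join_vec 0 :: real^'n \<Rightarrow> _)"
      using bounded_linear_join_vec_0' by (rule bounded_linear.linear)
    then have "(\<Sum>k\<in>UNIV. w $ k *\<^sub>R join_vec 0 (?E k (hpart d)) + (vpart d $ k) *\<^sub>R join_vec 0 (?D (axis k 1)))
      = join_vec 0 ((\<Sum>k\<in>UNIV. w $ k *\<^sub>R ?E k (hpart d)) + (\<Sum>k\<in>UNIV. vpart d $ k *\<^sub>R ?D (axis k 1)))"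
      by (simp only: sum.distrib linear_add linear_sum linear_cmul)
    then show "join_vec (?D (hpart d)) 0
      + (\<Sum>k\<in>UNIV. (vpart (join_vec x w) $ k) *\<^sub>R join_vec 0 (?E k (hpart d))
          + (vpart d $ k) *\<^sub>R join_vec 0 (frechet_derivative f (at (hpart (join_vec x w))) (axis k 1)))
      = join_vec (?D (hpart d))
          (frechet_derivative (\<lambda>x. frechet_derivative f (at x) w) (at x) (hpart d) + ?D (vpart d))"
      unfolding parts_join_vec 1 2 by (simp add: join_vec_add)
  qed
qed

lemma tangent_map_cong:
  assumes "open S" "hpart z \<in> S" "\<And>x. x \<in> S \<Longrightarrow> f x = g x" "f differentiable (at (hpart z))"
  shows "tangent_map f z = tangent_map g z"
  using frechet_derivative_transform_within_open[OF assms(4,1,2,3)] assms(2,3) by (simp add: tangent_map_def)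


section \<open>The atlas of the tangent bundle\<close>

lemma tangent_chart_simps [simp]:
  "fst (tangent_chart A c) = (SIGMA p:fst c. tangent_space A p)"
  "snd (tangent_chart A c) (p, y) = join_vec (snd c p) (y c)"
  by (simp_all add: tangent_chart_def join_vec_def)

context
  fixes A :: "('p, 'n::finite) chart set"
  assumes atlas: "smooth_atlas A"
begin

lemma tangent_chart_image:
  assumes "c \<in> A" "W \<subseteq> fst c"
  shows "snd (tangent_chart A c) ` (SIGMA p:W. tangent_space A p) = hpart -` (snd c ` W)"
proof (intro equalityI subsetI)
  fix z assume "z \<in> hpart -` (snd c ` W)"
  then obtain p where p: "p \<in> W" "hpart z = snd c p"
    by auto
  then have "z = snd (tangent_chart A c) (p, tangent_vector A c p (vpart z))"
    using assms tangent_vector_component[OF atlas, of c p] by (auto simp flip: p(2))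
  then show "z \<in> snd (tangent_chart A c) ` (SIGMA p:W. tangent_space A p)"
    using p(1) assms tangent_vector_in[OF atlas, of c p] by (intro image_eqI) auto
qed auto

lemma tangent_chart_inj:
  assumes "c \<in> A"
  shows "inj_on (snd (tangent_chart A c)) (fst (tangent_chart A c))"
proof (rule inj_onI, clarsimp)
  fix p y p' y'
  assume *: "p \<in> fst c" "p' \<in> fst c" "y \<in> tangent_space A p" "y' \<in> tangent_space A p'"
    "join_vec (snd c p) (y c) = join_vec (snd c p') (y' c)"
  then have "snd c p = snd c p'" "y c = y' c"
    by (metis parts_join_vec)+
  with * chart_inj[OF atlas assms] have "p = p'"
    by (auto dest: inj_onD)
  with * \<open>y c = y' c\<close> tangent_space_eqI[OF atlas assms] show "p = p' \<and> y = y'"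
    by blast
qed

lemma tangent_chart_inv:
  assumes "c \<in> A" "hpart z \<in> snd c ` fst c"
  shows "chart_inv (tangent_chart A c) z
    = (chart_inv c (hpart z), tangent_vector A c (chart_inv c (hpart z)) (vpart z))"
  unfolding chart_inv_def[of "tangent_chart A c"]
proof (rule inv_into_f_eq[OF tangent_chart_inj[OF assms(1)]])
  show "(chart_inv c (hpart z), tangent_vector A c (chart_inv c (hpart z)) (vpart z)) \<in> fst (tangent_chart A c)"
    using assms tangent_vector_in[OF atlas assms(1)] by (simp add: chart_inv_chart[OF atlas])
  show "snd (tangent_chart A c) (chart_inv c (hpart z), tangent_vector A c (chart_inv c (hpart z)) (vpart z)) = z"
    using assms tangent_vector_component[OF atlas assms(1)] by (simp add: chart_inv_chart[OF atlas])
qed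

lemma tangent_transition_eq:
  assumes "c \<in> A" "c' \<in> A" "hpart z \<in> snd c ` (fst c \<inter> fst c')"
  shows "(snd (tangent_chart A c') \<circ> chart_inv (tangent_chart A c)) z = tangent_map (snd c' \<circ> chart_inv c) z"
proof -
  obtain p where p: "p \<in> fst c" "p \<in> fst c'" "hpart z = snd c p"
    using assms(3) by auto
  have "chart_inv (tangent_chart A c) z = (p, tangent_vector A c p (vpart z))"
    using tangent_chart_inv[OF assms(1), of z] p assms(1) by (simp add: chart_inv_chart[OF atlas])
  then show ?thesis
    using p assms by (simp add: tangent_map_def tangent_vector_def transition_deriv_def chart_inv_chart[OF atlas])
qed

lemma tangent_chart_Int:
  "fst (tangent_chart A c) \<inter> fst (tangent_chart A c') = (SIGMA p:fst c \<inter> fst c'. tangent_space A p)"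
  by auto

text \<open>Transition maps of the tangent bundle are tangent maps of transition maps, hence smooth.\<close>

lemma smooth_atlas_tangent: "smooth_atlas (tangent_atlas A)"
  unfolding smooth_atlas_def tangent_atlas_def
proof (intro conjI ballI; elim imageE; hypsubst)
  fix c assume c: "c \<in> A"
  show "inj_on (snd (tangent_chart A c)) (fst (tangent_chart A c))"
    by (rule tangent_chart_inj[OF c])
  show "open (snd (tangent_chart A c) ` fst (tangent_chart A c))"
    using open_vimage_hpart[OF chart_open[OF atlas c]] tangent_chart_image[OF c order_refl] by simp
next
  fix c c' assume c: "c \<in> A" "c' \<in> A"
  have im: "snd (tangent_chart A c) ` (fst (tangent_chart A c) \<inter> fst (tangent_chart A c'))
      = hpart -` (snd c ` (fst c \<inter> fst c'))"
    unfolding tangent_chart_Int by (rule tangent_chart_image) (use c in auto)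
  have op: "open (snd c ` (fst c \<inter> fst c'))"
    by (rule chart_open_Int[OF atlas c])
  show "open (snd (tangent_chart A c) ` (fst (tangent_chart A c) \<inter> fst (tangent_chart A c')))"
    unfolding im by (rule open_vimage_hpart[OF op])
  show "smooth_on (snd (tangent_chart A c) ` (fst (tangent_chart A c) \<inter> fst (tangent_chart A c')))
     (snd (tangent_chart A c') \<circ> chart_inv (tangent_chart A c))"
    unfolding im
    by (rule smooth_on_cong[OF open_vimage_hpart[OF op] _
          smooth_on_tangent_map[OF op transition_smooth[OF atlas c]]])
      (use tangent_transition_eq[OF c] in auto)
qed

lemma tangent_transition_deriv:
  assumes "c \<in> A" "c' \<in> A" "p \<in> fst c" "p \<in> fst c'"
  shows "transition_deriv (tangent_chart A c) (tangent_chart A c') (p, y) d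
    = join_vec (transition_deriv c c' p (hpart d))
        (frechet_derivative (\<lambda>x. frechet_derivative (snd c' \<circ> chart_inv c) (at x) (y c)) (at (snd c p)) (hpart d)
          + transition_deriv c c' p (vpart d))"
proof -
  have op: "open (snd c ` (fst c \<inter> fst c'))"
    by (rule chart_open_Int[OF atlas assms(1,2)])
  have x: "snd c p \<in> snd c ` (fst c \<inter> fst c')"
    using assms by auto
  have "((snd (tangent_chart A c') \<circ> chart_inv (tangent_chart A c)) has_derivative
    (\<lambda>d. join_vec (transition_deriv c c' p (hpart d))
        (frechet_derivative (\<lambda>x. frechet_derivative (snd c' \<circ> chart_inv c) (at x) (y c)) (at (snd c p)) (hpart d)
          + transition_deriv c c' p (vpart d)))) (at (join_vec (snd c p) (y c)))"
    unfolding transition_deriv_def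
    by (rule has_derivative_transform_within_open[OF
          tangent_map_has_derivative[OF op transition_smooth[OF atlas assms(1,2)] x] open_vimage_hpart[OF op]])
      (use x tangent_transition_eq[OF assms(1,2)] in auto)
  from fun_cong[OF frechet_derivative_at[OF this], of d] show ?thesis
    by (simp add: transition_deriv_def[of "tangent_chart A c"])
qed

end


section \<open>Complete and vertical lifts of vector fields\<close>

text \<open>A tangent vector of the tangent bundle is a function of the charts of the bundle, while the
  components of \<open>X\<close> belong to charts of the base. They are recovered from a bundle chart \<open>C\<close>
  alone because \<open>C\<close> maps the pair \<open>(p, X p)\<close> to a vector whose last half is the component vector of
  \<open>X\<close> at \<open>p\<close>. So no bundle chart has to be traced back to a chart of the base.\<close>

definition base_components ::
    "('p \<Rightarrow> ('p, 'n::finite) tvec) \<Rightarrow> ('p \<times> ('p, 'n) tvec, 'n + 'n) chart \<Rightarrow> real^'n \<Rightarrow> real^'n" where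
  "base_components X C x = (let p = fst (chart_inv C (join_vec x 0)) in vpart (snd C (p, X p)))"

text \<open>In coordinates the complete lift is $X^i \partial/\partial x^i + y^k (\partial X^i/\partial x^k)
  \partial/\partial y^i$. Unlike the horizontal lift it involves no connection, and on the zero
  section both agree.\<close>

definition complete_lift ::
    "('p, 'n::finite) chart set \<Rightarrow> ('p \<Rightarrow> ('p, 'n) tvec) \<Rightarrow> 'p \<times> ('p, 'n) tvec
       \<Rightarrow> ('p \<times> ('p, 'n) tvec, 'n + 'n) tvec" where
  "complete_lift A X z C =
     (if C \<in> tangent_atlas A \<and> z \<in> fst C then tangent_map (base_components X C) (snd C z) else 0)"

definition vertical_lift ::
    "('p, 'n::finite) chart set \<Rightarrow> ('p \<Rightarrow> ('p, 'n) tvec) \<Rightarrow> 'p \<times> ('p, 'n) tvec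
       \<Rightarrow> ('p \<times> ('p, 'n) tvec, 'n + 'n) tvec" where
  "vertical_lift A X z C =
     (if C \<in> tangent_atlas A \<and> z \<in> fst C
      then join_vec 0 (base_components X C (hpart (snd C z))) else 0)"

context
  fixes A :: "('p, 'n::finite) chart set" and X :: "'p \<Rightarrow> ('p, 'n) tvec"
  assumes atlas: "smooth_atlas A" and X: "vector_field A X"
begin

lemma base_components_eq:
  assumes "c \<in> A" "x \<in> snd c ` fst c"
  shows "base_components X (tangent_chart A c) x = X (chart_inv c x) c"
  using assms by (simp add: base_components_def tangent_chart_inv[OF atlas])

lemma base_components_smooth:
  assumes "c \<in> A"
  shows "smooth_on (snd c ` fst c) (base_components X (tangent_chart A c))"
  by (rule smooth_on_cong[OF chart_open[OF atlas assms] base_components_eq[OF assms, symmetric]])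
    (use X assms in \<open>auto simp: vector_field_def\<close>)

lemma base_components_transition:
  assumes "c \<in> A" "c' \<in> A" "p \<in> fst c" "p \<in> fst c'"
  shows "base_components X (tangent_chart A c') (snd c' p)
    = transition_deriv c c' p (base_components X (tangent_chart A c) (snd c p))"
proof -
  have "X p \<in> tangent_space A p"
    using X assms by (auto simp: vector_field_def points_def)
  then show ?thesis
    using assms tangent_space_transition[OF atlas _ assms(1,2)] by (simp add: base_components_eq chart_inv_chart[OF atlas])
qed

text \<open>Differentiating the transformation law \<open>X'(f(x)) = Df(x) X(x)\<close> in the direction \<open>y\<close> produces
  \<open>D\<^sup>2f(x)(y, X)\<close>, whereas the Jacobian of the bundle transition map at \<open>(x, y)\<close> produces
  \<open>D\<^sup>2f(x)(X, y)\<close>. They agree because second derivatives are symmetric.\<close>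

lemma complete_lift_transition:
  assumes c: "c \<in> A" "c' \<in> A" and p: "p \<in> fst c" "p \<in> fst c'" and y: "y \<in> tangent_space A p"
  shows "tangent_map (base_components X (tangent_chart A c')) (join_vec (snd c' p) (y c'))
    = transition_deriv (tangent_chart A c) (tangent_chart A c') (p, y)
        (tangent_map (base_components X (tangent_chart A c)) (join_vec (snd c p) (y c)))"
proof -
  let ?f = "snd c' \<circ> chart_inv c" and ?x = "snd c p"
  let ?X = "base_components X (tangent_chart A c)" and ?X' = "base_components X (tangent_chart A c')"
  let ?S = "snd c ` (fst c \<inter> fst c')"
  have op: "open ?S" and sm: "smooth_on ?S ?f"
    using chart_open_Int[OF atlas c] transition_smooth[OF atlas c] .
  have x: "?x \<in> ?S" "?x \<in> snd c ` fst c" "?f ?x \<in> snd c' ` fst c'"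
    using p c by (auto simp: chart_inv_chart[OF atlas])
  have fx: "?f ?x = snd c' p"
    using p c by (simp add: chart_inv_chart[OF atlas])
  have df: "(?f has_derivative transition_deriv c c' p) (at ?x)"
    by (rule transition_has_derivative[OF atlas c p])
  have dX: "(?X has_derivative frechet_derivative ?X (at ?x)) (at ?x)"
    by (rule has_frechet_derivative[OF smooth_on_differentiable[OF base_components_smooth[OF c(1)] x(2)]])
  have dX': "(?X' has_derivative frechet_derivative ?X' (at (snd c' p))) (at (?f ?x))"
    using has_frechet_derivative[OF smooth_on_differentiable[OF base_components_smooth[OF c(2)] x(3)]] by (simp only: fx)
  have yc': "y c' = transition_deriv c c' p (y c)"
    by (rule tangent_space_transition[OF atlas y c p])
  have 1: "((\<lambda>x. ?X' (?f x)) has_derivative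
      (\<lambda>w. frechet_derivative ?X' (at (snd c' p)) (transition_deriv c c' p w))) (at ?x)"
    by (rule has_derivative_compose[OF df dX'])
  have inner: "((\<lambda>x. join_vec x (?X x)) has_derivative (\<lambda>w. join_vec w (frechet_derivative ?X (at ?x) w))) (at ?x)"
  proof -
    have "((\<lambda>x. join_vec x 0 + join_vec 0 (?X x)) has_derivative
        (\<lambda>w. join_vec w 0 + join_vec 0 (frechet_derivative ?X (at ?x) w))) (at ?x)"
      by (intro has_derivative_add bounded_linear_imp_has_derivative bounded_linear_join_vec_0
          bounded_linear.has_derivative[OF bounded_linear_join_vec_0'] dX)
    then show ?thesis
      by (simp add: join_vec_add)
  qed
  have "((\<lambda>x. vpart (tangent_map ?f (join_vec x (?X x)))) has_derivative
      (\<lambda>w. vpart (join_vec (frechet_derivative ?f (at ?x) (hpart (join_vec w (frechet_derivative ?X (at ?x) w))))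
        (frechet_derivative (\<lambda>x. frechet_derivative ?f (at x) (?X ?x)) (at ?x) (hpart (join_vec w (frechet_derivative ?X (at ?x) w)))
        + frechet_derivative ?f (at ?x) (vpart (join_vec w (frechet_derivative ?X (at ?x) w))))))) (at ?x)"
    by (rule bounded_linear.has_derivative[OF bounded_linear_vpart
          has_derivative_compose[OF inner tangent_map_has_derivative[OF op sm x(1)]]])
  then have "((\<lambda>x. frechet_derivative ?f (at x) (?X x)) has_derivative
      (\<lambda>w. frechet_derivative (\<lambda>x. frechet_derivative ?f (at x) (?X ?x)) (at ?x) w
        + transition_deriv c c' p (frechet_derivative ?X (at ?x) w))) (at ?x)"
    by (simp add: tangent_map_def transition_deriv_def)
  then have "((\<lambda>x. ?X' (?f x)) has_derivative
      (\<lambda>w. frechet_derivative (\<lambda>x. frechet_derivative ?f (at x) (?X ?x)) (at ?x) w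
        + transition_deriv c c' p (frechet_derivative ?X (at ?x) w))) (at ?x)"
  proof (rule has_derivative_transform_within_open[OF _ op x(1)])
    fix x assume "x \<in> ?S"
    then obtain q where "q \<in> fst c" "q \<in> fst c'" "x = snd c q"
      by auto
    then show "frechet_derivative ?f (at x) (?X x) = ?X' (?f x)"
      using base_components_transition[OF c, of q] c by (simp add: chart_inv_chart[OF atlas] transition_deriv_def)
  qed
  from fun_cong[OF has_derivative_unique[OF 1 this], of "y c"]
  have "frechet_derivative ?X' (at (snd c' p)) (y c')
      = frechet_derivative (\<lambda>x. frechet_derivative ?f (at x) (?X ?x)) (at ?x) (y c)
        + transition_deriv c c' p (frechet_derivative ?X (at ?x) (y c))"
    by (simp add: yc')
  also have "frechet_derivative (\<lambda>x. frechet_derivative ?f (at x) (?X ?x)) (at ?x) (y c)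
      = frechet_derivative (\<lambda>x. frechet_derivative ?f (at x) (y c)) (at ?x) (?X ?x)"
    by (rule mixed_derivatives_eq[OF op sm x(1)])
  finally show ?thesis
    using base_components_transition[OF c p]
    by (simp add: tangent_transition_deriv[OF atlas c p] tangent_map_def)
qed

lemma complete_lift_component:
  assumes "c \<in> A" "p \<in> fst c" "y \<in> tangent_space A p"
  shows "complete_lift A X (p, y) (tangent_chart A c)
    = tangent_map (\<lambda>x. X (chart_inv c x) c) (join_vec (snd c p) (y c))"
proof -
  have "complete_lift A X (p, y) (tangent_chart A c)
      = tangent_map (base_components X (tangent_chart A c)) (join_vec (snd c p) (y c))"
    using assms by (simp add: complete_lift_def tangent_atlas_def)
  also have "\<dots> = tangent_map (\<lambda>x. X (chart_inv c x) c) (join_vec (snd c p) (y c))"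
    by (rule tangent_map_cong[OF chart_open[OF atlas assms(1)]])
      (use assms base_components_eq smooth_on_differentiable[OF base_components_smooth] in auto)
  finally show ?thesis .
qed

lemma vertical_lift_component:
  assumes "c \<in> A" "p \<in> fst c" "y \<in> tangent_space A p"
  shows "vertical_lift A X (p, y) (tangent_chart A c) = join_vec 0 (X p c)"
  using assms by (simp add: vertical_lift_def tangent_atlas_def base_components_eq chart_inv_chart[OF atlas])

lemma vector_field_complete_lift: "vector_field (tangent_atlas A) (complete_lift A X)"
  unfolding vector_field_def
proof (intro conjI ballI)
  fix z
  show "complete_lift A X z \<in> tangent_space (tangent_atlas A) z"
    unfolding tangent_space_def
  proof (intro CollectI conjI ballI allI impI)
    fix C C' assume "C \<in> tangent_atlas A" "C' \<in> tangent_atlas A" "z \<in> fst C \<and> z \<in> fst C'"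
    then obtain c c' p y where *: "C = tangent_chart A c" "C' = tangent_chart A c'" "c \<in> A" "c' \<in> A"
      "z = (p, y)" "p \<in> fst c" "p \<in> fst c'" "y \<in> tangent_space A p"
      by (cases z) (auto simp: tangent_atlas_def)
    then have "complete_lift A X z C' = tangent_map (base_components X C') (join_vec (snd c' p) (y c'))"
      "complete_lift A X z C = tangent_map (base_components X C) (join_vec (snd c p) (y c))"
      by (simp_all add: complete_lift_def tangent_atlas_def)
    then show "complete_lift A X z C' = transition_deriv C C' z (complete_lift A X z C)"
      unfolding * by (simp only: complete_lift_transition[OF *(3,4,6,7,8)])
  qed (auto simp: complete_lift_def)
next
  fix C assume "C \<in> tangent_atlas A"
  then obtain c where C: "C = tangent_chart A c" "c \<in> A"
    by (auto simp: tangent_atlas_def)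
  let ?S = "hpart -` (snd c ` fst c)"
  have im: "snd C ` fst C = ?S"
    using C tangent_chart_image[OF atlas C(2) order_refl] by simp
  have op: "open (snd c ` fst c)"
    by (rule chart_open[OF atlas C(2)])
  show "smooth_on (snd C ` fst C) (\<lambda>z. complete_lift A X (chart_inv C z) C)"
    unfolding im
  proof (rule smooth_on_cong[OF open_vimage_hpart[OF op] _ smooth_on_tangent_map[OF op base_components_smooth[OF C(2)]]])
    fix z assume z: "z \<in> ?S"
    then have "chart_inv C z \<in> fst C" "snd C (chart_inv C z) = z"
      using im by (auto simp: chart_inv_def inv_into_into f_inv_into_f)
    then show "tangent_map (base_components X (tangent_chart A c)) z = complete_lift A X (chart_inv C z) C"
      using \<open>C \<in> tangent_atlas A\<close> by (simp add: complete_lift_def C)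
  qed
qed

lemma vector_field_vertical_lift: "vector_field (tangent_atlas A) (vertical_lift A X)"
  unfolding vector_field_def
proof (intro conjI ballI)
  fix z
  show "vertical_lift A X z \<in> tangent_space (tangent_atlas A) z"
    unfolding tangent_space_def
  proof (intro CollectI conjI ballI allI impI)
    fix C C' assume "C \<in> tangent_atlas A" "C' \<in> tangent_atlas A" "z \<in> fst C \<and> z \<in> fst C'"
    then obtain c c' p y where *: "C = tangent_chart A c" "C' = tangent_chart A c'" "c \<in> A" "c' \<in> A"
      "z = (p, y)" "p \<in> fst c" "p \<in> fst c'" "y \<in> tangent_space A p"
      by (cases z) (auto simp: tangent_atlas_def)
    let ?F = "\<lambda>x. frechet_derivative (snd c' \<circ> chart_inv c) (at x) (y c)"
    have "?F differentiable (at (snd c p))"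
      by (rule smooth_on_differentiable[OF smooth_on_frechet_derivative[OF
            chart_open_Int[OF atlas *(3,4)] transition_smooth[OF atlas *(3,4)]]]) (use * in auto)
    then have "frechet_derivative ?F (at (snd c p)) 0 = 0"
      by (rule linear_0[OF linear_frechet_derivative])
    moreover have "transition_deriv c c' p 0 = 0"
      by (rule linear_0[OF bounded_linear.linear[OF bounded_linear_transition_deriv[OF atlas *(3,4,6,7)]]])
    ultimately show "vertical_lift A X z C' = transition_deriv C C' z (vertical_lift A X z C)"
      using * by (simp add: vertical_lift_def tangent_atlas_def tangent_transition_deriv[OF atlas]
          base_components_transition[OF *(3,4,6,7)])
  qed (auto simp: vertical_lift_def)
next
  fix C assume "C \<in> tangent_atlas A"
  then obtain c where C: "C = tangent_chart A c" "c \<in> A"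
    by (auto simp: tangent_atlas_def)
  let ?S = "hpart -` (snd c ` fst c)"
  have im: "snd C ` fst C = ?S"
    using C tangent_chart_image[OF atlas C(2) order_refl] by simp
  have op: "open (snd c ` fst c)"
    by (rule chart_open[OF atlas C(2)])
  have "smooth_on ?S (\<lambda>z. join_vec 0 (base_components X (tangent_chart A c) (hpart z)))"
    by (intro smooth_on_bounded_linear_comp[OF bounded_linear_join_vec_0']
        smooth_on_comp_bounded_linear[OF bounded_linear_hpart _ base_components_smooth[OF C(2)]]) auto
  then show "smooth_on (snd C ` fst C) (\<lambda>z. vertical_lift A X (chart_inv C z) C)"
    unfolding im
  proof (rule smooth_on_cong[OF open_vimage_hpart[OF op], rotated])
    fix z assume z: "z \<in> ?S"
    then have "chart_inv C z \<in> fst C" "snd C (chart_inv C z) = z"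
      using im by (auto simp: chart_inv_def inv_into_into f_inv_into_f)
    then show "join_vec 0 (base_components X (tangent_chart A c) (hpart z)) = vertical_lift A X (chart_inv C z) C"
      using \<open>C \<in> tangent_atlas A\<close> by (simp add: vertical_lift_def C)
  qed
qed

end


section \<open>Derivatives at the zero section\<close>

abbreviation zero_at :: "'p \<Rightarrow> 'p \<times> ('p, 'n::finite) tvec" where
  "zero_at p \<equiv> (p, \<lambda>_. 0)"

text \<open>This computes a derivative at 0 without differentiating \<open>K\<close>, which below collects all
  terms of a coefficient of \<open>G\<close> that carry a factor \<open>s\<close>.\<close>

lemma has_real_derivative_id_times:
  fixes K :: "real \<Rightarrow> real"
  assumes "isCont K 0"
  shows "((\<lambda>s. s * K s) has_real_derivative K 0) (at 0)"
proof -
  have "((\<lambda>s. (s * K s - 0 * K 0) / (s - 0)) \<longlongrightarrow> K 0) (at 0)"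
    by (rule Lim_transform_eventually[OF assms[unfolded isCont_def]]) (auto simp: eventually_at_filter)
  then show ?thesis
    by (simp add: has_field_derivative_iff)
qed

text \<open>The energy density along a line through the origin of a fibre has the form \<open>s\<^sup>2 a / 2\<close>.
  Its derivative vanishes at \<open>s = 0\<close>, so the one-sided derivative of \<open>f\<close> at 0 is enough.\<close>

lemma smooth_halfline_square:
  assumes "smooth_halfline f" "a \<ge> 0"
  shows "((\<lambda>s. f (s * s * a / 2)) has_real_derivative 0) (at 0)"
proof -
  obtain D where "D 0 = f" "\<forall>k. \<forall>t\<ge>0. (D k has_real_derivative D (Suc k) t) (at t within {0..})"
    using assms(1) unfolding smooth_halfline_def by blast
  then have "(f has_real_derivative D (Suc 0) 0) (at 0 within {0..})"
    by (metis order_refl)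
  moreover have "range (\<lambda>s. s * s * a / 2) \<subseteq> {0..}"
    using assms(2) by auto
  ultimately have "(f has_real_derivative D (Suc 0) 0) (at (0 * 0 * a / 2) within range (\<lambda>s. s * s * a / 2))"
    using DERIV_subset by simp
  moreover have "((\<lambda>s. s * s * a / 2) has_real_derivative 0) (at 0)"
    by (auto intro!: derivative_eq_intros)
  ultimately have "(f \<circ> (\<lambda>s. s * s * a / 2) has_real_derivative D (Suc 0) 0 * 0) (at 0)"
    by (rule DERIV_image_chain)
  then show ?thesis
    by (simp add: comp_def)
qed

context
  fixes A :: "('p, 'n::finite) chart set"
  assumes atlas: "smooth_atlas A"
begin

lemma zero_in_tangent_space: "(\<lambda>_. 0) \<in> tangent_space A p"
  using tangent_space_sum[OF atlas, of "{}" "\<lambda>_ _. 0"] by simp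

lemma zero_at_in: "c \<in> A \<Longrightarrow> p \<in> fst c \<Longrightarrow> zero_at p \<in> fst (tangent_chart A c)"
  by (simp add: zero_in_tangent_space)

lemma chart_inv_zero_section:
  assumes "c \<in> A" "x \<in> snd c ` fst c"
  shows "chart_inv (tangent_chart A c) (join_vec x 0) = zero_at (chart_inv c x)"
proof -
  have "tangent_vector A c (chart_inv c x) 0 = (\<lambda>_. 0)"
    using tangent_vector_of_component[OF atlas assms(1) _ zero_in_tangent_space] assms(2) by simp
  then show ?thesis
    using assms by (simp add: tangent_chart_inv[OF atlas])
qed

text \<open>Derivatives in the base directions can be computed on the zero section alone. The
  differentiability assumption cannot be dropped, as \<open>partial_deriv\<close> refers to the total derivative.\<close>

lemma partial_deriv_zero_section:
  assumes "c \<in> A" "p \<in> fst c"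
    and diff: "(\<lambda>z. F (chart_inv (tangent_chart A c) z)) differentiable (at (join_vec (snd c p) 0))"
    and restr: "\<And>q. q \<in> fst c \<Longrightarrow> F (zero_at q) = f q"
  shows "partial_deriv (tangent_chart A c) (Inl i) F (zero_at p) = partial_deriv c i f p"
proof -
  let ?F = "F \<circ> chart_inv (tangent_chart A c)"
  have "(?F has_derivative frechet_derivative ?F (at (join_vec (snd c p) 0))) (at (join_vec (snd c p) 0))"
    using diff by (intro has_frechet_derivative) (simp add: comp_def)
  from has_derivative_compose[OF bounded_linear_imp_has_derivative[OF bounded_linear_join_vec_0] this]
  have "((f \<circ> chart_inv c) has_derivative (\<lambda>v. frechet_derivative ?F (at (join_vec (snd c p) 0)) (join_vec v 0)))
      (at (snd c p))"
    by (rule has_derivative_transform_within_open[OF _ chart_open[OF atlas assms(1)]])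
      (use assms restr in \<open>auto simp: chart_inv_zero_section chart_inv_chart[OF atlas]\<close>)
  from fun_cong[OF frechet_derivative_at[OF this]] show ?thesis
    by (simp add: partial_deriv_def axis_Inl)
qed

lemma partial_deriv_fibre:
  assumes "c \<in> A" "p \<in> fst c"
    and diff: "(\<lambda>z. F (chart_inv (tangent_chart A c) z)) differentiable (at (join_vec (snd c p) 0))"
    and D: "((\<lambda>s. F (p, tangent_vector A c p (s *\<^sub>R axis j 1))) has_real_derivative D) (at 0)"
  shows "partial_deriv (tangent_chart A c) (Inr j) F (zero_at p) = D"
proof -
  let ?F = "F \<circ> chart_inv (tangent_chart A c)" and ?z = "join_vec (snd c p) 0"
  let ?l = "\<lambda>s. ?z + join_vec 0 (s *\<^sub>R axis j 1)"
  have F: "(?F has_derivative frechet_derivative ?F (at ?z)) (at ?z)"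
    using diff by (intro has_frechet_derivative) (simp add: comp_def)
  have "linear (join_vec 0 :: real^'n \<Rightarrow> _)"
    using bounded_linear_join_vec_0' by (rule bounded_linear.linear)
  then have join: "join_vec 0 (s *\<^sub>R axis j 1 :: real^'n) = s *\<^sub>R join_vec 0 (axis j 1)" for s
    by (simp add: linear_cmul)
  have "(?l has_derivative (\<lambda>s. s *\<^sub>R join_vec 0 (axis j 1))) (at 0)"
    unfolding join by (auto intro!: derivative_eq_intros)
  moreover have "(?F has_derivative frechet_derivative ?F (at ?z)) (at (?l 0))"
    using F by (simp add: join_vec_add)
  ultimately have "((\<lambda>s. ?F (?l s)) has_derivative
      (\<lambda>s. frechet_derivative ?F (at ?z) (s *\<^sub>R join_vec 0 (axis j 1)))) (at 0)"
    by (rule has_derivative_compose)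
  moreover have "?F (?l s) = F (p, tangent_vector A c p (s *\<^sub>R axis j 1))" for s
    using assms(1,2) by (simp add: join_vec_add tangent_chart_inv[OF atlas] chart_inv_chart[OF atlas])
  ultimately have "((\<lambda>s. F (p, tangent_vector A c p (s *\<^sub>R axis j 1))) has_derivative
      (\<lambda>s. frechet_derivative ?F (at ?z) (s *\<^sub>R join_vec 0 (axis j 1)))) (at 0)"
    by simp
  moreover have "((\<lambda>s. F (p, tangent_vector A c p (s *\<^sub>R axis j 1))) has_derivative (*) D) (at 0)"
    using D by (simp add: has_field_derivative_def)
  ultimately have "(\<lambda>s. frechet_derivative ?F (at ?z) (s *\<^sub>R join_vec 0 (axis j 1))) = (*) D"
    by (rule has_derivative_unique)
  from fun_cong[OF this, of 1] show ?thesis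
    by (simp add: partial_deriv_def axis_Inr)
qed

lemma partial_deriv_cmult:
  assumes "c \<in> A" "p \<in> fst c" "(\<lambda>x. f (chart_inv c x)) differentiable (at (snd c p))"
  shows "partial_deriv c i (\<lambda>q. a * f q) p = a * partial_deriv c i f p"
  using frechet_derivative_bounded_linear_comp[OF bounded_linear_mult_right assms(3), of a]
  by (simp add: partial_deriv_def comp_def)

end


section \<open>A general natural lift along the zero section\<close>

context
  fixes A :: "('p, 'n::finite) chart set"
    and g :: "('p, 'n) metric"
    and G :: "('p \<times> ('p, 'n) tvec, 'n + 'n) metric"
    and c1 c2 c3 d1 d2 d3 :: "real \<Rightarrow> real"
  assumes atlas: "smooth_atlas A"
    and g: "riemannian_metric A g"
    and G: "riemannian_metric (tangent_atlas A) G"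
    and smooth: "\<forall>f\<in>{c1, c2, c3, d1, d2, d3}. smooth_halfline f"
    and lift: "\<forall>c\<in>A. \<forall>p\<in>fst c. \<forall>y\<in>tangent_space A p. \<forall>i j.
           let z = (p, y); t = energy g z;
               gij = metric_coeff A g c i j p;
               g0ij = metric_coeff0 A g c i z * metric_coeff0 A g c j z;
               hor = \<lambda>i. horizontal_frame A g c i z;
               ver = \<lambda>i. vertical_frame A c i z
           in G z (hor i) (hor j) = c1 t * gij + d1 t * g0ij \<and>
              G z (ver i) (ver j) = c2 t * gij + d2 t * g0ij \<and>
              G z (ver i) (hor j) = c3 t * gij + d3 t * g0ij \<and>
              G z (hor i) (ver j) = c3 t * gij + d3 t * g0ij"
begin

context
  fixes c :: "('p, 'n) chart"
  assumes c: "c \<in> A"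
begin

abbreviation (input) TA where "TA \<equiv> tangent_atlas A"
abbreviation (input) TC where "TC \<equiv> tangent_chart A c"
abbreviation (input) gc where "gc \<equiv> metric_coeff A g c"
abbreviation (input) Gc where "Gc \<equiv> metric_coeff TA G TC"
abbreviation (input) \<Gamma> where "\<Gamma> \<equiv> christoffel A g c"

lemma TC: "TC \<in> TA"
  using c by (simp add: tangent_atlas_def)

lemma TA: "smooth_atlas TA"
  by (rule smooth_atlas_tangent[OF atlas])

text \<open>The coordinate field $\partial/\partial x^i$ is $\delta/\delta x^i + \Gamma^h_{0i}
  \partial/\partial y^h$.\<close>

lemma lift_coord_vector:
  assumes p: "p \<in> fst c" and y: "y \<in> tangent_space A p" and w: "w \<in> tangent_space TA (p, y)"
  shows "G (p, y) (coord_vector TA TC (Inl i) (p, y)) w = G (p, y) (horizontal_frame A g c i (p, y)) w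
    + (\<Sum>h\<in>UNIV. christoffel0 A g c h i (p, y) * G (p, y) (vertical_frame A c h (p, y)) w)"
proof -
  let ?z = "(p, y)"
  let ?E = "\<lambda>a. coord_vector TA TC a ?z"
  let ?a = "\<lambda>h. christoffel0 A g c h i ?z"
  have z: "?z \<in> fst TC" "?z \<in> points TA"
    using p y c by (auto simp: points_def tangent_atlas_def)
  note E = coord_vector_in[OF TA TC z(1)]
  have S: "(\<lambda>C. \<Sum>h\<in>UNIV. ?a h *\<^sub>R ?E (Inr h) C) \<in> tangent_space TA ?z"
    by (rule tangent_space_sum[OF TA E])
  have "horizontal_frame A g c i ?z = (\<lambda>C. 1 *\<^sub>R ?E (Inl i) C + (-1) *\<^sub>R (\<Sum>h\<in>UNIV. ?a h *\<^sub>R ?E (Inr h) C))"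
    by (simp add: horizontal_frame_def vertical_frame_def)
  then have "G ?z (horizontal_frame A g c i ?z) w
      = 1 * G ?z (?E (Inl i)) w + (-1) * G ?z (\<lambda>C. \<Sum>h\<in>UNIV. ?a h *\<^sub>R ?E (Inr h) C) w"
    by (simp only: metric_linear[OF TA G z(2) E S w])
  also have "G ?z (\<lambda>C. \<Sum>h\<in>UNIV. ?a h *\<^sub>R ?E (Inr h) C) w = (\<Sum>h\<in>UNIV. ?a h * G ?z (?E (Inr h)) w)"
    by (rule metric_sum[OF TA G z(2) finite E w])
  finally show ?thesis
    by (simp add: vertical_frame_def)
qed

lemma horizontal_frame_in:
  assumes p: "p \<in> fst c" and y: "y \<in> tangent_space A p"
  shows "horizontal_frame A g c i (p, y) \<in> tangent_space TA (p, y)"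
proof -
  let ?u = "\<lambda>a. coord_vector TA TC a (p, y)"
  let ?a = "\<lambda>a. case a of Inl j \<Rightarrow> (if j = i then 1 else 0) | Inr h \<Rightarrow> - christoffel0 A g c h i (p, y)"
  have z: "(p, y) \<in> fst TC"
    using p y by simp
  have "(\<lambda>C. \<Sum>a\<in>UNIV. ?a a *\<^sub>R ?u a C) \<in> tangent_space TA (p, y)"
    by (rule tangent_space_sum[OF TA coord_vector_in[OF TA TC z]])
  also have "(\<lambda>C. \<Sum>a\<in>UNIV. ?a a *\<^sub>R ?u a C) = horizontal_frame A g c i (p, y)"
    by (simp add: fun_eq_iff sum_UNIV_sum horizontal_frame_def vertical_frame_def if_distrib sum_negf
        if_distribR cong: if_cong)
  finally show ?thesis .
qed

text \<open>The natural lift is prescribed in the adapted frame, whereas Christoffel symbols are defined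
  by the coordinate frame. These are the coefficients in the latter.\<close>

lemma lift_coeffs:
  assumes p: "p \<in> fst c" and y: "y \<in> tangent_space A p"
  defines "t \<equiv> energy g (p, y)" and "g0 \<equiv> \<lambda>i. metric_coeff0 A g c i (p, y)"
    and "a \<equiv> \<lambda>h i. christoffel0 A g c h i (p, y)"
  shows "Gc (Inr i) (Inr j) (p, y) = c2 t * gc i j p + d2 t * (g0 i * g0 j)"
    and "Gc (Inl i) (Inr j) (p, y) = c3 t * gc i j p + d3 t * (g0 i * g0 j)
          + (\<Sum>h\<in>UNIV. a h i * (c2 t * gc h j p + d2 t * (g0 h * g0 j)))"
    and "Gc (Inl i) (Inl j) (p, y) = c1 t * gc i j p + d1 t * (g0 i * g0 j)
          + (\<Sum>h\<in>UNIV. a h j * (c3 t * gc h i p + d3 t * (g0 h * g0 i)))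
          + (\<Sum>h\<in>UNIV. a h i * (c3 t * gc j h p + d3 t * (g0 j * g0 h)
              + (\<Sum>l\<in>UNIV. a l j * (c2 t * gc l h p + d2 t * (g0 l * g0 h)))))"
proof -
  let ?z = "(p, y)"
  let ?H = "\<lambda>i. horizontal_frame A g c i ?z" and ?V = "\<lambda>i. vertical_frame A c i ?z"
    and ?E = "\<lambda>i. coord_vector TA TC (Inl i) ?z"
  have z: "?z \<in> fst TC" "?z \<in> points TA"
    using p y c by (auto simp: points_def tangent_atlas_def)
  have G: "G ?z (?H i) (?H j) = c1 t * gc i j p + d1 t * (g0 i * g0 j)"
    "G ?z (?V i) (?V j) = c2 t * gc i j p + d2 t * (g0 i * g0 j)"
    "G ?z (?V i) (?H j) = c3 t * gc i j p + d3 t * (g0 i * g0 j)"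
    "G ?z (?H i) (?V j) = c3 t * gc i j p + d3 t * (g0 i * g0 j)" for i j
    using lift[unfolded Let_def] c p y unfolding t_def g0_def by blast+
  have V: "?V i \<in> tangent_space TA ?z" for i
    unfolding vertical_frame_def by (rule coord_vector_in[OF TA TC z(1)])
  have E: "?E i \<in> tangent_space TA ?z" for i
    by (rule coord_vector_in[OF TA TC z(1)])
  have H: "?H i \<in> tangent_space TA ?z" for i
    by (rule horizontal_frame_in[OF p y])
  have expand: "G ?z (?E i) w = G ?z (?H i) w + (\<Sum>h\<in>UNIV. a h i * G ?z (?V h) w)"
    if "w \<in> tangent_space TA ?z" for i w
    unfolding a_def by (rule lift_coord_vector[OF p y that])
  note sym = metric_sym[OF TA \<open>riemannian_metric TA G\<close> z(2)]
  show "Gc (Inr i) (Inr j) ?z = c2 t * gc i j p + d2 t * (g0 i * g0 j)" for i j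
    using G(2) by (simp add: metric_coeff_def[of TA] vertical_frame_def)
  have EV: "G ?z (?E i) (?V j) = c3 t * gc i j p + d3 t * (g0 i * g0 j)
          + (\<Sum>h\<in>UNIV. a h i * (c2 t * gc h j p + d2 t * (g0 h * g0 j)))" for i j
    by (simp add: expand[OF V] G)
  then show "Gc (Inl i) (Inr j) ?z = c3 t * gc i j p + d3 t * (g0 i * g0 j)
          + (\<Sum>h\<in>UNIV. a h i * (c2 t * gc h j p + d2 t * (g0 h * g0 j)))"
    by (simp add: metric_coeff_def[of TA] vertical_frame_def)
  have "Gc (Inl i) (Inl j) ?z = G ?z (?H i) (?E j) + (\<Sum>h\<in>UNIV. a h i * G ?z (?V h) (?E j))"
    by (simp add: metric_coeff_def[of TA] expand[OF E])
  also have "G ?z (?H i) (?E j) = G ?z (?E j) (?H i)"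
    by (rule sym[OF H E])
  also have "\<dots> = c1 t * gc j i p + d1 t * (g0 j * g0 i)
          + (\<Sum>h\<in>UNIV. a h j * (c3 t * gc h i p + d3 t * (g0 h * g0 i)))"
    by (simp add: expand[OF H] G)
  also have "gc j i p = gc i j p"
    by (rule metric_coeff_sym[OF atlas g c p])
  finally show "Gc (Inl i) (Inl j) ?z = c1 t * gc i j p + d1 t * (g0 i * g0 j)
          + (\<Sum>h\<in>UNIV. a h j * (c3 t * gc h i p + d3 t * (g0 h * g0 i)))
          + (\<Sum>h\<in>UNIV. a h i * (c3 t * gc j h p + d3 t * (g0 j * g0 h)
              + (\<Sum>l\<in>UNIV. a l j * (c2 t * gc l h p + d2 t * (g0 l * g0 h)))))"
    by (simp add: sym[OF V E] EV mult.commute[of "g0 j"])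
qed

lemma lift_coeffs_zero:
  assumes "q \<in> fst c"
  shows "Gc (Inr i) (Inr j) (zero_at q) = c2 0 * gc i j q"
    and "Gc (Inl i) (Inr j) (zero_at q) = c3 0 * gc i j q"
    and "Gc (Inr i) (Inl j) (zero_at q) = c3 0 * gc i j q"
proof -
  have [simp]: "energy g (zero_at q) = 0"
    using metric_eq_coeff[OF atlas g c assms zero_in_tangent_space[OF atlas] zero_in_tangent_space[OF atlas]]
    by (simp add: energy_def)
  have [simp]: "metric_coeff0 A g c i (zero_at q) = 0" "christoffel0 A g c h i (zero_at q) = 0" for h i
    by (simp_all add: metric_coeff0_def christoffel0_def)
  note coeffs = lift_coeffs[OF assms zero_in_tangent_space[OF atlas]]
  show "Gc (Inr i) (Inr j) (zero_at q) = c2 0 * gc i j q"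
    and *: "Gc (Inl i) (Inr j) (zero_at q) = c3 0 * gc i j q" for i j
    by (simp_all add: coeffs)
  show "Gc (Inr i) (Inl j) (zero_at q) = c3 0 * gc i j q"
    using metric_coeff_sym[OF TA G TC zero_at_in[OF atlas c assms], of "Inr i" "Inl j"]
      *[of j i] metric_coeff_sym[OF atlas g c assms, of i j] by simp
qed

context
  fixes p assumes p: "p \<in> fst c"
begin

lemma chart_zero: "join_vec (snd c p) 0 \<in> snd TC ` fst TC"
  using p tangent_chart_image[OF atlas c order_refl] by simp

lemma Gc_differentiable: "(\<lambda>z. Gc a b (chart_inv TC z)) differentiable (at (join_vec (snd c p) 0))"
  by (rule smooth_on_differentiable[OF metric_coeff_smooth[OF TA G TC] chart_zero])

lemma gc_differentiable: "(\<lambda>x. gc i j (chart_inv c x)) differentiable (at (snd c p))"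
  using smooth_on_differentiable[OF metric_coeff_smooth[OF atlas g c]] p by blast

lemma Gc_base_derivs:
  shows "partial_deriv TC (Inl k) (Gc (Inr i) (Inr j)) (zero_at p) = c2 0 * partial_deriv c k (gc i j) p"
    and "partial_deriv TC (Inl k) (Gc (Inl i) (Inr j)) (zero_at p) = c3 0 * partial_deriv c k (gc i j) p"
  unfolding partial_deriv_cmult[OF atlas c p gc_differentiable, symmetric]
  by (rule partial_deriv_zero_section[OF atlas c p Gc_differentiable], rule lift_coeffs_zero, assumption)+

text \<open>Along the fibre through \<open>p\<close>, in the direction $\partial/\partial y^k$, the coefficients have the form
  \<open>c(s\<^sup>2 g\<^sub>k\<^sub>k / 2) g\<^sub>i\<^sub>j + s K(s)\<close>. The first term has derivative 0 at \<open>s = 0\<close>, and \<open>K(0)\<close> comes from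
  the terms $\Gamma^h_{0i}$ of $\partial/\partial x^i$ only.\<close>

lemma Gc_fibre_derivs:
  shows "partial_deriv TC (Inr k) (Gc (Inl i) (Inr j)) (zero_at p) = c2 0 * christoffel1 A g c j k i p"
    and "partial_deriv TC (Inr k) (Gc (Inl i) (Inl j)) (zero_at p) = c3 0 * partial_deriv c k (gc i j) p"
proof -
  define y where "y s = tangent_vector A c p (s *\<^sub>R axis k 1)" for s
  have yT: "y s \<in> tangent_space A p" and yc: "y s c = s *\<^sub>R axis k 1" for s
    using tangent_vector_in[OF atlas c p] tangent_vector_component[OF atlas c p] by (simp_all add: y_def)
  have y_sum: "(\<Sum>l\<in>UNIV. y s c $ l * f l) = s * f k" for s f
    by (simp add: yc axis_def if_distrib[of "\<lambda>x. x * _"] if_distrib[of "\<lambda>x. _ * x"] cong: if_cong)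
  have energy: "energy g (p, y s) = s * s * gc k k p / 2" for s
    unfolding energy_def by (simp add: metric_eq_coeff[OF atlas g c p yT yT] y_sum mult.assoc flip: sum_distrib_left)
  have g0: "metric_coeff0 A g c i (p, y s) = s * gc k i p" for i s
    by (simp add: metric_coeff0_def y_sum)
  have a: "christoffel0 A g c h i (p, y s) = s * \<Gamma> h k i p" for h i s
    by (simp add: christoffel0_def y_sum)
  have "gc k k p \<ge> 0"
  proof -
    have "coord_vector A c k p \<noteq> (\<lambda>_. 0)"
      using coord_vector_component[OF atlas c p, of k] by (metis axis_eq_0_iff zero_neq_one)
    then show ?thesis
      using metric_pos[OF atlas g _ coord_vector_in[OF atlas c p], of k] c p
      by (force simp: metric_coeff_def points_def)
  qed
  then have deriv: "((\<lambda>s. f (s * s * gc k k p / 2)) has_real_derivative 0) (at 0)"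
    if "f \<in> {c1, c2, c3, d1, d2, d3}" for f
    using smooth_halfline_square smooth that by blast
  then have cont: "isCont (\<lambda>s. f (s * s * gc k k p / 2)) 0"
    if "f \<in> {c1, c2, c3, d1, d2, d3}" for f
    using that by (blast intro: DERIV_isCont)
  have conts: "isCont (\<lambda>s. c1 (s * s * gc k k p / 2)) 0" "isCont (\<lambda>s. c2 (s * s * gc k k p / 2)) 0"
    "isCont (\<lambda>s. c3 (s * s * gc k k p / 2)) 0" "isCont (\<lambda>s. d1 (s * s * gc k k p / 2)) 0"
    "isCont (\<lambda>s. d2 (s * s * gc k k p / 2)) 0" "isCont (\<lambda>s. d3 (s * s * gc k k p / 2)) 0"
    using cont[of c1] cont[of c2] cont[of c3] cont[of d1] cont[of d2] cont[of d3] by simp_all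
  let ?t = "\<lambda>s. s * s * gc k k p / 2"
  note lower = christoffel_lower[OF atlas g c p]
  note gsym = metric_coeff_sym[OF atlas g c p]
  let ?K = "\<lambda>s. d3 (?t s) * (gc k i p * (s * gc k j p))
    + (\<Sum>h\<in>UNIV. \<Gamma> h k i p * (c2 (?t s) * gc h j p + d2 (?t s) * (s * gc k h p * (s * gc k j p))))"
  have "((\<lambda>s. c3 (?t s) * gc i j p + s * ?K s) has_real_derivative 0 * gc i j p + ?K 0) (at 0)"
    using deriv[of c3]
    by (intro DERIV_add DERIV_cmult_right has_real_derivative_id_times) (auto intro!: continuous_intros conts)
  moreover have "c3 (?t s) * gc i j p + s * ?K s = Gc (Inl i) (Inr j) (p, y s)" for s
    by (simp add: lift_coeffs(2)[OF p yT] energy g0 a sum_distrib_left algebra_simps)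
  moreover have "0 * gc i j p + ?K 0 = c2 0 * christoffel1 A g c j k i p"
    by (simp add: lower[symmetric] sum_distrib_left gsym[of j] mult_ac)
  ultimately have "((\<lambda>s. Gc (Inl i) (Inr j) (p, y s)) has_real_derivative c2 0 * christoffel1 A g c j k i p) (at 0)"
    by simp
  from partial_deriv_fibre[OF atlas c p Gc_differentiable this[unfolded y_def]]
  show "partial_deriv TC (Inr k) (Gc (Inl i) (Inr j)) (zero_at p) = c2 0 * christoffel1 A g c j k i p" .
  let ?L = "\<lambda>s. d1 (?t s) * (gc k i p * (s * gc k j p))
    + (\<Sum>h\<in>UNIV. \<Gamma> h k j p * (c3 (?t s) * gc h i p + d3 (?t s) * (s * gc k h p * (s * gc k i p))))
    + (\<Sum>h\<in>UNIV. \<Gamma> h k i p * (c3 (?t s) * gc j h p + d3 (?t s) * (s * gc k j p * (s * gc k h p))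
        + (\<Sum>l\<in>UNIV. s * \<Gamma> l k j p * (c2 (?t s) * gc l h p + d2 (?t s) * (s * gc k l p * (s * gc k h p))))))"
  have "((\<lambda>s. c1 (?t s) * gc i j p + s * ?L s) has_real_derivative 0 * gc i j p + ?L 0) (at 0)"
    using deriv[of c1]
    by (intro DERIV_add DERIV_cmult_right has_real_derivative_id_times) (auto intro!: continuous_intros conts)
  moreover have "c1 (?t s) * gc i j p + s * ?L s = Gc (Inl i) (Inl j) (p, y s)" for s
    unfolding lift_coeffs(3)[OF p yT] energy g0 a
    by (simp add: sum_distrib_left distrib_left mult.assoc mult.left_commute)
  moreover have "0 * gc i j p + ?L 0 = c3 0 * (christoffel1 A g c i k j p + christoffel1 A g c j k i p)"
    by (simp add: lower[symmetric] sum_distrib_left gsym[of _ i] distrib_left mult_ac)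
  moreover have "christoffel1 A g c i k j p + christoffel1 A g c j k i p = partial_deriv c k (gc i j) p"
    using metric_coeff_sym_partial[OF atlas g c p]
    by (simp add: christoffel1_def[OF atlas g] field_simps)
  ultimately have "((\<lambda>s. Gc (Inl i) (Inl j) (p, y s)) has_real_derivative c3 0 * partial_deriv c k (gc i j) p) (at 0)"
    by simp
  from partial_deriv_fibre[OF atlas c p Gc_differentiable this[unfolded y_def]]
  show "partial_deriv TC (Inr k) (Gc (Inl i) (Inl j)) (zero_at p) = c3 0 * partial_deriv c k (gc i j) p" .
qed

lemma christoffel1_zero_section:
  shows "christoffel1 TA G TC (Inl k) (Inl i) (Inr j) (zero_at p) = c3 0 * christoffel1 A g c k i j p"
    and "christoffel1 TA G TC (Inr k) (Inl i) (Inr j) (zero_at p) = c2 0 * christoffel1 A g c k i j p"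
proof -
  note gs = metric_coeff_sym_partial[OF atlas g c p]
  note Gs = metric_coeff_sym_partial[OF TA G TC zero_at_in[OF atlas c p]]
  show "christoffel1 TA G TC (Inl k) (Inl i) (Inr j) (zero_at p) = c3 0 * christoffel1 A g c k i j p"
    by (simp add: christoffel1_def[OF TA G] christoffel1_def[OF atlas g] Gc_base_derivs Gc_fibre_derivs algebra_simps)
  have "partial_deriv TC (Inr j) (Gc (Inr k) (Inl i)) (zero_at p) = c2 0 * christoffel1 A g c k j i p"
    by (simp add: Gs[of _ "Inr k"] Gc_fibre_derivs)
  then show "christoffel1 TA G TC (Inr k) (Inl i) (Inr j) (zero_at p) = c2 0 * christoffel1 A g c k i j p"
    by (simp add: christoffel1_def[OF TA G] christoffel1_def[OF atlas g] Gc_base_derivs Gc_fibre_derivs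
        gs[of _ j i] gs[of _ k j] gs[of _ k i] field_simps)
qed

text \<open>By \<open>christoffel1_zero_section\<close> both halves of the lowered symbol are constant multiples
  of the lowered symbol of \<open>g\<close>, with the same constants \<open>c\<^sub>3(0)\<close> and \<open>c\<^sub>2(0)\<close> that multiply \<open>g\<close> in the
  coefficients of \<open>G\<close> against vertical vectors. Raising the index gives a vertical vector.\<close>

lemma christoffel_zero_section:
  shows "christoffel TA G TC (Inl h) (Inl i) (Inr j) (zero_at p) = 0"
    and "christoffel TA G TC (Inr h) (Inl i) (Inr j) (zero_at p) = \<Gamma> h i j p"
proof -
  let ?\<gamma> = "\<lambda>a. case a of Inl h \<Rightarrow> 0 | Inr h \<Rightarrow> \<Gamma> h i j p"
  have "(\<Sum>a\<in>UNIV. Gc b a (zero_at p) * ?\<gamma> a) = christoffel1 TA G TC b (Inl i) (Inr j) (zero_at p)" for b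
    by (cases b) (simp_all add: sum_UNIV_sum lift_coeffs_zero[OF p] christoffel1_zero_section
        mult.assoc christoffel_lower[OF atlas g c p] flip: sum_distrib_left)
  then have "christoffel TA G TC a (Inl i) (Inr j) (zero_at p) = ?\<gamma> a" for a
    by (rule christoffel_eqI[OF TA G TC zero_at_in[OF atlas c p]])
  from this[of "Inl h"] this[of "Inr h"]
  show "christoffel TA G TC (Inl h) (Inl i) (Inr j) (zero_at p) = 0"
    and "christoffel TA G TC (Inr h) (Inl i) (Inr j) (zero_at p) = \<Gamma> h i j p"
    by simp_all
qed

text \<open>The field \<open>E\<close> has to be vertical on the zero section only, so the lemma applies again to the
  covariant derivative that it produces.\<close>

lemma levi_civita_zero_section:
  assumes D: "D (zero_at p) TC = join_vec (X p c) 0"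
    and E: "\<And>q. q \<in> fst c \<Longrightarrow> E (zero_at q) TC = join_vec 0 (V q c)"
    and diff: "\<And>a. (\<lambda>z. E (chart_inv TC z) TC $ a) differentiable (at (join_vec (snd c p) 0))"
  shows "levi_civita TA G D E (zero_at p) TC = join_vec 0 (levi_civita A g X V p c)"
proof -
  have 1: "partial_deriv TC (Inl i) (\<lambda>z. E z TC $ Inl h) (zero_at p) = 0" for i h
  proof -
    have "partial_deriv TC (Inl i) (\<lambda>z. E z TC $ Inl h) (zero_at p) = partial_deriv c i (\<lambda>q. 0) p"
      by (rule partial_deriv_zero_section[OF atlas c p diff]) (simp add: E)
    then show ?thesis
      by (simp add: partial_deriv_def comp_def)
  qed
  have 2: "partial_deriv TC (Inl i) (\<lambda>z. E z TC $ Inr h) (zero_at p) = partial_deriv c i (\<lambda>q. V q c $ h) p" for i h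
    by (rule partial_deriv_zero_section[OF atlas c p diff]) (simp add: E)
  show ?thesis
    using c p TC zero_at_in[OF atlas c p]
    by (simp add: vec_sum_eq_iff levi_civita_def sum_UNIV_sum D E[OF p] 1 2 christoffel_zero_section)
qed

lemma lie_bracket_zero_section:
  assumes X: "\<And>q. q \<in> fst c \<Longrightarrow> D (zero_at q) TC = join_vec (X q c) 0"
    and Y: "\<And>q. q \<in> fst c \<Longrightarrow> E (zero_at q) TC = join_vec (Y q c) 0"
    and diff: "\<And>a. (\<lambda>z. D (chart_inv TC z) TC $ a) differentiable (at (join_vec (snd c p) 0))"
      "\<And>a. (\<lambda>z. E (chart_inv TC z) TC $ a) differentiable (at (join_vec (snd c p) 0))"
  shows "lie_bracket TA D E (zero_at p) TC = join_vec (lie_bracket A X Y p c) 0"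
proof -
  have der: "partial_deriv TC (Inl i) (\<lambda>z. F z TC $ Inl h) (zero_at p) = partial_deriv c i (\<lambda>q. W q c $ h) p"
    "partial_deriv TC (Inl i) (\<lambda>z. F z TC $ Inr h) (zero_at p) = 0"
    if F: "\<And>q. q \<in> fst c \<Longrightarrow> F (zero_at q) TC = join_vec (W q c) 0"
      and diff: "\<And>a. (\<lambda>z. F (chart_inv TC z) TC $ a) differentiable (at (join_vec (snd c p) 0))" for F W i h
  proof -
    show "partial_deriv TC (Inl i) (\<lambda>z. F z TC $ Inl h) (zero_at p) = partial_deriv c i (\<lambda>q. W q c $ h) p"
      by (rule partial_deriv_zero_section[OF atlas c p diff]) (simp add: F)
    have "partial_deriv TC (Inl i) (\<lambda>z. F z TC $ Inr h) (zero_at p) = partial_deriv c i (\<lambda>q. 0) p"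
      by (rule partial_deriv_zero_section[OF atlas c p diff]) (simp add: F)
    then show "partial_deriv TC (Inl i) (\<lambda>z. F z TC $ Inr h) (zero_at p) = 0"
      by (simp add: partial_deriv_def comp_def)
  qed
  show ?thesis
    using c p TC zero_at_in[OF atlas c p]
    by (simp add: vec_sum_eq_iff lie_bracket_def sum_UNIV_sum X[OF p] Y[OF p]
        der[of D X, OF X diff(1)] der[of E Y, OF Y diff(2)] sum_subtractf)
qed

end

lemma complete_lift_zero_section:
  assumes "vector_field A X" "q \<in> fst c"
  shows "complete_lift A X (zero_at q) TC = join_vec (X q c) 0"
proof -
  have "(\<lambda>x. X (chart_inv c x) c) differentiable (at (snd c q))"
    using assms c smooth_on_differentiable[of "snd c ` fst c"] by (auto simp: vector_field_def)
  from linear_0[OF linear_frechet_derivative[OF this]]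
  show ?thesis
    by (simp add: complete_lift_component[OF atlas assms(1) c assms(2) zero_in_tangent_space[OF atlas]]
        tangent_map_def chart_inv_chart[OF atlas c assms(2)])
qed

text \<open>All three terms of the curvature differentiate in directions tangent to the zero section, so
  each of them is the vertical copy of the corresponding term on the base.\<close>

lemma curvature_zero_section:
  assumes p: "p \<in> fst c" and X: "vector_field A X" and Y: "vector_field A Y" and Z: "vector_field A Z"
  shows "curvature TA G (complete_lift A X) (complete_lift A Y) (vertical_lift A Z) (zero_at p) TC
    = join_vec 0 (curvature A g X Y Z p c)"
proof -
  note T0 = zero_in_tangent_space[OF atlas]
  note comp = complete_lift_zero_section
  have vert: "vertical_lift A Z (zero_at q) TC = join_vec 0 (Z q c)" if "q \<in> fst c" for q
    by (rule vertical_lift_component[OF atlas Z c that T0])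
  have XT: "vector_field TA (complete_lift A X)" and YT: "vector_field TA (complete_lift A Y)"
    and ZT: "vector_field TA (vertical_lift A Z)"
    using vector_field_complete_lift[OF atlas] vector_field_vertical_lift[OF atlas] X Y Z by blast+
  have diff: "(\<lambda>z. F (chart_inv TC z) TC $ a) differentiable (at (join_vec (snd c q) 0))"
    if "vector_field TA F" "q \<in> fst c" for F a q
    by (rule smooth_on_differentiable[OF vector_field_component_smooth[OF TA that(1) TC] chart_zero[OF that(2)]])
  have nabla: "levi_civita TA G (complete_lift A X) (vertical_lift A Z) (zero_at q) TC
      = join_vec 0 (levi_civita A g X Z q c)" if "vector_field A X" "q \<in> fst c" for X q
    by (rule levi_civita_zero_section[where D = "complete_lift A X" and E = "vertical_lift A Z", OF that(2)])
      (use that comp vert diff[OF ZT] in auto)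
  have nabla_diff: "(\<lambda>z. levi_civita TA G (complete_lift A X) (vertical_lift A Z) (chart_inv TC z) TC $ a)
      differentiable (at (join_vec (snd c p) 0))" if "vector_field A X" for X a
    by (rule levi_civita_differentiable[OF TA G TC chart_zero[OF p] vector_field_complete_lift[OF atlas that] ZT])
  have nabla2: "levi_civita TA G (complete_lift A X) (levi_civita TA G (complete_lift A Y) (vertical_lift A Z)) (zero_at p) TC
      = join_vec 0 (levi_civita A g X (levi_civita A g Y Z) p c)"
    if "vector_field A X" "vector_field A Y" for X Y
    by (rule levi_civita_zero_section[where D = "complete_lift A X"
          and E = "levi_civita TA G (complete_lift A Y) (vertical_lift A Z)", OF p])
      (use that p comp nabla nabla_diff in auto)
  have bracket: "lie_bracket TA (complete_lift A X) (complete_lift A Y) (zero_at p) TC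
      = join_vec (lie_bracket A X Y p c) 0"
    by (rule lie_bracket_zero_section[where D = "complete_lift A X" and E = "complete_lift A Y", OF p])
      (use p comp X Y diff[OF XT] diff[OF YT] in auto)
  have "levi_civita TA G (lie_bracket TA (complete_lift A X) (complete_lift A Y)) (vertical_lift A Z) (zero_at p) TC
      = join_vec 0 (levi_civita A g (lie_bracket A X Y) Z p c)"
    by (rule levi_civita_zero_section[where D = "lie_bracket TA (complete_lift A X) (complete_lift A Y)"
          and E = "vertical_lift A Z", OF p])
      (use p bracket vert diff[OF ZT] in auto)
  then show ?thesis
    using nabla2[OF X Y] nabla2[OF Y X] by (simp add: curvature_def vec_sum_eq_iff)
qed

text \<open>Constant sectional curvature makes the left-hand side of \<open>curvature_zero_section\<close> a
  combination of horizontal vectors, and the right-hand side is vertical.\<close>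

lemma curvature_eq_0:
  assumes p: "p \<in> fst c" and X: "vector_field A X" and Y: "vector_field A Y" and Z: "vector_field A Z"
    and k: "constant_sectional_curvature TA G k"
  shows "curvature A g X Y Z p c = 0"
proof -
  have "zero_at p \<in> points TA"
    unfolding points_def using TC zero_at_in[OF atlas c p] by (rule UN_I)
  then have "curvature TA G (complete_lift A X) (complete_lift A Y) (vertical_lift A Z) (zero_at p) TC
    = k *\<^sub>R (G (zero_at p) (complete_lift A Y (zero_at p)) (vertical_lift A Z (zero_at p)) *\<^sub>R complete_lift A X (zero_at p) TC
      - G (zero_at p) (complete_lift A X (zero_at p)) (vertical_lift A Z (zero_at p)) *\<^sub>R complete_lift A Y (zero_at p) TC)"
    using k[unfolded constant_sectional_curvature_def, THEN spec, THEN spec, THEN spec, THEN mp, THEN bspec,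
        OF conjI[OF vector_field_complete_lift[OF atlas X] conjI[OF vector_field_complete_lift[OF atlas Y]
          vector_field_vertical_lift[OF atlas Z]]], THEN fun_cong]
    by blast
  then show ?thesis
    unfolding curvature_zero_section[OF p X Y Z] complete_lift_zero_section[OF X p] complete_lift_zero_section[OF Y p]
    by (simp add: vec_sum_eq_iff vec_eq_iff)
qed

end

end

theorem proposition1:
  fixes A :: "('p, 'n::finite) chart set"
    and g :: "('p, 'n) metric"
    and G :: "('p \<times> ('p, 'n) tvec, 'n + 'n) metric"
  assumes "riemannian_manifold A g"
    and "general_natural_lift A g G"
    and "riemannian_metric (tangent_atlas A) G"
    and "\<exists>k. constant_sectional_curvature (tangent_atlas A) G k"
  shows "flat A g"
  unfolding flat_def
proof (intro allI impI ballI ext)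
  fix X Y Z p c
  assume fields: "vector_field A X \<and> vector_field A Y \<and> vector_field A Z" and "p \<in> points A"
  have atlas: "smooth_atlas A" and g: "riemannian_metric A g"
    using assms(1) by (simp_all add: riemannian_manifold_def smooth_manifold_def)
  obtain k where k: "constant_sectional_curvature (tangent_atlas A) G k"
    using assms(4) by blast
  show "curvature A g X Y Z p c = 0"
  proof (cases "c \<in> A \<and> p \<in> fst c")
    case True
    from assms(2) show ?thesis
      unfolding general_natural_lift_def
      by (elim exE conjE) (rule curvature_eq_0[OF atlas g assms(3) _ _ conjunct1[OF True] conjunct2[OF True] _ _ _ k];
          (assumption | use fields in blast))
  next
    case False
    then show ?thesis
      by (auto simp: curvature_def levi_civita_def)
  qed
qed

end
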